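(* Let $b$ satisfy (b1)–(b4), let $\lambda\colon\Omega\to[0,1]$ be Borel and $u\in BV(\Omega)\cap L^\infty(\Omega)$. Assume that for every sequence $(u_n)\in\mathcal A(u)$, $$\int_\Omega\varphi\,d(b(\cdot,u),Du)_\lambda\le\liminf_{n\to\infty}\int_\Omega\varphi\,d(b(\cdot,u_n),Du_n)_\lambda\qquad\forall\varphi\in C^\infty_c(\Omega),\ \varphi\ge0.$$ Then $F(x,u^\lambda(x))=\max_{t\in[u^-(x),u^+(x)]}F(x,t)$ for $\sigma$-a.e. $x\in\Omega$; equivalently $(b(\cdot,u),Du)_\lambda=(b(\cdot,u),Du)_L$.
   Context: $\Omega\subseteq\mathbb R^N$ ($N\ge2$) open; $\mathcal{DM}^\infty(\Omega)$ = fields $A\in L^\infty(\Omega;\mathbb R^N)$ with distributional divergence a finite Radon measure. Assumptions on $b\colon\Omega\times\mathbb R\to\mathbb R^N$: (b1) Borel and bounded; (b2) for a.e. $x$, $t\mapsto b(x,t)$ continuous; (b3) $b_t:=b(\cdot,t)\in\mathcal{DM}^\infty(\Omega)$ for all $t$; (b4) $\sigma:=\bigvee_t|\operatorname{div}_xb_t|$ (least upper bound of measures) is a finite Radon measure. $f(\cdot,t)=d\operatorname{div}_xb_t/d\sigma$, $B(x,t)=\int_0^tb(x,s)ds$, $F(x,t)=\int_0^tf(x,s)ds$. $u^\pm$ approximate upper/lower limits, $u^\lambda=(1-\lambda)u^-+\lambda u^+$. $(b(\cdot,u),Du)_\lambda:=-F(x,u^\lambda)\sigma+\operatorname{div}(B(x,u(x)))$;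 $(b(\cdot,u),Du)_L:=-\widehat{\mathcal F}(x,u^-,u^+)\sigma+\operatorname{div}(B(x,u(x)))$ with $\widehat{\mathcal F}(x,a,b):=\max_{t\in[a,b]}F(x,t)$. $\mathcal A(u)$: sequences $(u_n)\subset BV\cap L^\infty$ with (i) $u_n\to u$ in $L^1$; (ii) $u^-\le\liminf_nu_n^-\le\limsup_nu_n^+\le u^+$ $\sigma$-a.e.; (iii) some $g\in L^1(\Omega;\sigma)$ with $|u_n^\pm|\le g$ $\sigma$-a.e. for all $n$. *)

theory Defs
  imports "HOL-Analysis.Analysis"
begin

fun iter_partial :: "'a::euclidean_space list \<Rightarrow> ('a \<Rightarrow> real) \<Rightarrow> 'a \<Rightarrow> real" where
  "iter_partial [] \<phi> = \<phi>"
| "iter_partial (v # vs) \<phi> = (\<lambda>x. frechet_derivative (iter_partial vs \<phi>) (at x) v)"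

definition smooth_fun :: "('a::euclidean_space \<Rightarrow> real) \<Rightarrow> bool" where
  "smooth_fun \<phi> \<longleftrightarrow> (\<forall>vs. set vs \<subseteq> Basis \<longrightarrow> iter_partial vs \<phi> differentiable_on UNIV)"

definition test_fun :: "'a::euclidean_space set \<Rightarrow> ('a \<Rightarrow> real) \<Rightarrow> bool" where
  "test_fun \<Omega> \<phi> \<longleftrightarrow> smooth_fun \<phi> \<and> (\<exists>K. compact K \<and> K \<subseteq> \<Omega> \<and> (\<forall>x. x \<notin> K \<longrightarrow> \<phi> x = 0))"

definition grad :: "('a::euclidean_space \<Rightarrow> real) \<Rightarrow> 'a \<Rightarrow> 'a" where
  "grad \<phi> x = (\<Sum>i\<in>Basis. frechet_derivative \<phi> (at x) i *\<^sub>R i)"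

text \<open>A finite positive Borel measure concentrated on Omega (= finite Radon measure on Omega).\<close>
definition fin_meas_on :: "'a::euclidean_space set \<Rightarrow> 'a measure \<Rightarrow> bool" where
  "fin_meas_on \<Omega> \<mu> \<longleftrightarrow> sets \<mu> = sets borel \<and> finite_measure \<mu> \<and> emeasure \<mu> (UNIV - \<Omega>) = 0"

definition meas_le :: "'a::topological_space measure \<Rightarrow> 'a measure \<Rightarrow> bool" where
  "meas_le \<mu> \<nu> \<longleftrightarrow> (\<forall>A\<in>sets borel. emeasure \<mu> A \<le> emeasure \<nu> A)"

text \<open>u in BV(Omega): u in L^1(Omega) and each distributional partial derivative is a
  finite signed Radon measure on Omega (written as a difference of two finite measures).\<close>
definition BV :: "'a::euclidean_space set \<Rightarrow> ('a \<Rightarrow> real) \<Rightarrow> bool" where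
  "BV \<Omega> u \<longleftrightarrow> set_integrable lebesgue \<Omega> u \<and>
     (\<forall>i\<in>Basis. \<exists>\<mu>1 \<mu>2. fin_meas_on \<Omega> \<mu>1 \<and> fin_meas_on \<Omega> \<mu>2 \<and>
        (\<forall>\<phi>. test_fun \<Omega> \<phi> \<longrightarrow>
           (LINT x:\<Omega>|lebesgue. u x * (grad \<phi> x \<bullet> i)) =
             - ((\<integral>x. \<phi> x \<partial>\<mu>1) - (\<integral>x. \<phi> x \<partial>\<mu>2))))"

definition Linf :: "'a::euclidean_space set \<Rightarrow> ('a \<Rightarrow> real) \<Rightarrow> bool" where
  "Linf \<Omega> u \<longleftrightarrow> (\<exists>C. AE x in lebesgue. x \<in> \<Omega> \<longrightarrow> \<bar>u x\<bar> \<le> C)"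

definition dens_zero :: "'a::euclidean_space set \<Rightarrow> 'a \<Rightarrow> bool" where
  "dens_zero E x \<longleftrightarrow>
     ((\<lambda>r. measure lebesgue (ball x r \<inter> E) / measure lebesgue (ball x r)) \<longlongrightarrow> 0) (at_right 0)"

definition ap_upper :: "'a::euclidean_space set \<Rightarrow> ('a \<Rightarrow> real) \<Rightarrow> 'a \<Rightarrow> real" where
  "ap_upper \<Omega> u x = Inf {t. dens_zero {y\<in>\<Omega>. u y > t} x}"

definition ap_lower :: "'a::euclidean_space set \<Rightarrow> ('a \<Rightarrow> real) \<Rightarrow> 'a \<Rightarrow> real" where
  "ap_lower \<Omega> u x = Sup {t. dens_zero {y\<in>\<Omega>. u y < t} x}"

definition u_lam :: "'a::euclidean_space set \<Rightarrow> ('a \<Rightarrow> real) \<Rightarrow> ('a \<Rightarrow> real) \<Rightarrow> 'a \<Rightarrow> real" where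
  "u_lam \<Omega> lam u x = (1 - lam x) * ap_lower \<Omega> u x + lam x * ap_upper \<Omega> u x"

definition Bprim :: "('a \<Rightarrow> real \<Rightarrow> 'a::euclidean_space) \<Rightarrow> 'a \<Rightarrow> real \<Rightarrow> 'a" where
  "Bprim b x t = (LBINT s=0..t. b x s)"

definition Fprim :: "('a \<Rightarrow> real \<Rightarrow> real) \<Rightarrow> 'a \<Rightarrow> real \<Rightarrow> real" where
  "Fprim f x t = (LBINT s=0..t. f x s)"

definition Fhat :: "('a \<Rightarrow> real \<Rightarrow> real) \<Rightarrow> 'a \<Rightarrow> real \<Rightarrow> real \<Rightarrow> real" where
  "Fhat f x a c = (SUP t\<in>{a..c}. Fprim f x t)"

text \<open>integral of phi against (b(.,v),Dv)_lambda = -F(x,v^lambda) sigma + div(B(x,v(x))),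
  where the divergence term is taken in the distributional sense:
  integral of phi against div G = - integral of G . grad phi.\<close>
definition pairing_lam ::
  "'a::euclidean_space set \<Rightarrow> 'a measure \<Rightarrow> ('a \<Rightarrow> real \<Rightarrow> 'a) \<Rightarrow> ('a \<Rightarrow> real \<Rightarrow> real)
     \<Rightarrow> ('a \<Rightarrow> real) \<Rightarrow> ('a \<Rightarrow> real) \<Rightarrow> ('a \<Rightarrow> real) \<Rightarrow> real" where
  "pairing_lam \<Omega> \<sigma> b f lam v \<phi> =
     - (\<integral>x. \<phi> x * Fprim f x (u_lam \<Omega> lam v x) \<partial>\<sigma>)
     - (LINT x:\<Omega>|lebesgue. Bprim b x (v x) \<bullet> grad \<phi> x)"

definition adm_seq ::
  "'a::euclidean_space set \<Rightarrow> 'a measure \<Rightarrow> ('a \<Rightarrow> real) \<Rightarrow> (nat \<Rightarrow> 'a \<Rightarrow> real) \<Rightarrow> bool" where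
  "adm_seq \<Omega> \<sigma> u us \<longleftrightarrow>
     (\<forall>n. BV \<Omega> (us n) \<and> Linf \<Omega> (us n)) \<and>
     ((\<lambda>n. LINT x:\<Omega>|lebesgue. \<bar>us n x - u x\<bar>) \<longlonglongrightarrow> 0) \<and>
     (AE x in \<sigma>. ereal (ap_lower \<Omega> u x) \<le> liminf (\<lambda>n. ereal (ap_lower \<Omega> (us n) x)) \<and>
                 liminf (\<lambda>n. ereal (ap_lower \<Omega> (us n) x)) \<le> limsup (\<lambda>n. ereal (ap_upper \<Omega> (us n) x)) \<and>
                 limsup (\<lambda>n. ereal (ap_upper \<Omega> (us n) x)) \<le> ereal (ap_upper \<Omega> u x)) \<and>
     (\<exists>g. integrable \<sigma> g \<and>
        (\<forall>n. AE x in \<sigma>. \<bar>ap_upper \<Omega> (us n) x\<bar> \<le> g x \<and> \<bar>ap_lower \<Omega> (us n) x\<bar> \<le> g x))"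

end

theory Submission
  imports Defs
begin

text \<open>
  It suffices to show, for every rational \<open>q\<close>, that \<open>F(x,q) \<le> F(x,u\<^sup>\<lambda>(x))\<close> for \<open>\<sigma>\<close>-a.e. \<open>x\<close> with
  \<open>u\<^sup>-(x) < q < u\<^sup>+(x)\<close>, because \<open>F(x,\<cdot>)\<close> is Lipschitz: \<open>\<sigma>\<close> dominates every \<open>\<bar>div b\<^sub>t\<bar>\<close>, so
  \<open>\<bar>f\<bar> \<le> 1\<close> by Fubini. If the inequality failed on a set of positive \<open>\<sigma>\<close>-measure, it would fail on a
  compact set \<open>K\<close> with \<open>\<sigma>(K) > 0\<close>, and \<open>K\<close> is Lebesgue null by the density theorem. Let
  \<open>u\<^sub>n = (1 - \<eta>\<^sub>n) u + \<eta>\<^sub>n q\<close> with smooth cutoffs \<open>\<eta>\<^sub>n\<close> that equal 1 near \<open>K\<close> and whose supports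
  shrink to \<open>K\<close>. Admissibility of a sequence does not bound the total variations, so \<open>(u\<^sub>n)\<close> is
  admissible although they may blow up; its one-sided approximate limits equal \<open>q\<close> on \<open>K\<close> and are
  eventually those of \<open>u\<close> off \<open>K\<close>. Passing to the limit in the lower semicontinuity inequality with a
  test function equal to 1 on \<open>K\<close> yields \<open>\<integral>\<^sub>K (F(x,q) - F(x,u\<^sup>\<lambda>)) d\<sigma> \<le> 0\<close>, a contradiction.
\<close>

section \<open>Smooth functions and cutoffs\<close>

text \<open>A maximiser of \<open>F(x,.)\<close> over the jump interval depends on \<open>x\<close>,
  and interpolating \<open>u\<close> with a function of \<open>x\<close> could leave
  \<open>BV\<close>. Hence the comparison value is a constant \<open>q\<close>, and countably many
  \<open>q\<close> are treated one at a time. The strict inequalities \<open>u^- < q < u^+\<close>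
  on \<open>K\<close> make the modified sequence admissible there; they also make \<open>K\<close>
  Lebesgue null, because almost every point is a density point of \<open>{u < q}\<close> or of
  \<open>{u \<ge> q}\<close>. Compactness of \<open>K\<close> lets the cutoffs equal 1 on a whole
  neighbourhood of \<open>K\<close>, so that the approximate limits, being local, are exactly
  \<open>q\<close> on \<open>K\<close> and \<lambda> drops out.

  The two terms of the pairing see different measures. The divergence term is an integral against
  Lebesgue measure and does not notice a change on \<open>K\<close>; the term with \<open>F\<close>
  is an integral against \<sigma>, which charges \<open>K\<close>. Since \<sigma> may charge
  Lebesgue null sets, the approximate limits of a merely Lebesgue measurable function have to be
  shown Borel measurable, which is the reason for the work on sets of points of density
  zero.\<close>

lemma smooth_fun_coinduct:
  assumes "\<phi> \<in> A"
    and "\<And>\<psi>. \<psi> \<in> A \<Longrightarrow> \<psi> differentiable_on UNIV"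
    and "\<And>\<psi> i. \<psi> \<in> A \<Longrightarrow> i \<in> Basis \<Longrightarrow> (\<lambda>x. frechet_derivative \<psi> (at x) i) \<in> A"
  shows "smooth_fun \<phi>"
proof -
  \<comment> \<open>Iterated partials never leave a class closed under partials, so smoothness
    follows from one round of differentiation, as for a greatest fixed point.\<close>
  have "set vs \<subseteq> Basis \<Longrightarrow> iter_partial vs \<phi> \<in> A" for vs
    by (induction vs) (use assms in auto)
  then show ?thesis
    unfolding smooth_fun_def using assms(2) by blast
qed

lemma iter_partial_append: "iter_partial (us @ vs) \<phi> = iter_partial us (iter_partial vs \<phi>)"
  by (induction us) simp_all

lemma smooth_fun_partial:
  assumes "smooth_fun \<phi>" "i \<in> Basis"
  shows "smooth_fun (\<lambda>x. frechet_derivative \<phi> (at x) i)"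
  unfolding smooth_fun_def
proof (intro allI impI)
  fix vs :: "'a list" assume "set vs \<subseteq> Basis"
  \<comment> \<open>\<open>iter_partial\<close> differentiates along the last entry of the list
    first, so the new direction goes at the end.\<close>
  then have "iter_partial (vs @ [i]) \<phi> differentiable_on UNIV"
    using assms unfolding smooth_fun_def by (metis append_Nil2 set_append set_simps Un_insert_right insert_subset)
  then show "iter_partial vs (\<lambda>x. frechet_derivative \<phi> (at x) i) differentiable_on UNIV"
    by (simp add: iter_partial_append)
qed

lemma smooth_fun_differentiable: "smooth_fun \<phi> \<Longrightarrow> \<phi> differentiable (at x)"
  unfolding smooth_fun_def
  by (metis UNIV_I differentiable_on_def empty_subsetI iter_partial.simps(1) list.set(1))

lemma smooth_fun_has_derivative:
  "smooth_fun \<phi> \<Longrightarrow> (\<phi> has_derivative frechet_derivative \<phi> (at x)) (at x)"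
  using frechet_derivative_works smooth_fun_differentiable by blast

lemma smooth_fun_continuous_on: "smooth_fun \<phi> \<Longrightarrow> continuous_on S \<phi>"
  by (meson continuous_at_imp_continuous_on differentiable_imp_continuous_within smooth_fun_differentiable)

lemma smooth_fun_measurable: "smooth_fun \<phi> \<Longrightarrow> \<phi> \<in> borel_measurable borel"
  by (simp add: borel_measurable_continuous_onI smooth_fun_continuous_on)

text \<open>The whole tower of derivatives is the witness, so that differentiation is a shift of the
  index. Functions of this kind serve as outer functions in compositions.\<close>

definition smooth_real :: "(real \<Rightarrow> real) \<Rightarrow> bool" where
  "smooth_real h \<longleftrightarrow> (\<exists>D. D 0 = h \<and> (\<forall>n::nat. \<forall>x. (D n has_real_derivative D (Suc n) x) (at x)))"

lemma smooth_real_deriv: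
  assumes "smooth_real h"
  obtains h' where "smooth_real h'" "\<And>x. (h has_real_derivative h' x) (at x)"
proof -
  obtain D where D: "D 0 = h" "\<And>n x. (D n has_real_derivative D (Suc n) x) (at x)"
    using assms unfolding smooth_real_def by blast
  have "smooth_real (D (Suc 0))"
    unfolding smooth_real_def by (rule exI[of _ "\<lambda>n. D (Suc n)"]) (simp add: D)
  then show thesis
    using that D by metis
qed

text \<open>A class to feed to \<open>smooth_fun_coinduct\<close>. Partials of products, reciprocals
  and compositions are again built by these operations, so closing under all of them at once
  replaces formulas for higher derivatives.\<close>

inductive_set smooth_closure :: "('a::euclidean_space \<Rightarrow> real) set" where
  base: "smooth_fun \<phi> \<Longrightarrow> \<phi> \<in> smooth_closure"
| add: "\<phi> \<in> smooth_closure \<Longrightarrow> \<psi> \<in> smooth_closure \<Longrightarrow> (\<lambda>x. \<phi> x + \<psi> x) \<in> smooth_closure"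
| mult: "\<phi> \<in> smooth_closure \<Longrightarrow> \<psi> \<in> smooth_closure \<Longrightarrow> (\<lambda>x. \<phi> x * \<psi> x) \<in> smooth_closure"
| inv: "\<phi> \<in> smooth_closure \<Longrightarrow> (\<And>x. \<phi> x > 0) \<Longrightarrow> (\<lambda>x. inverse (\<phi> x)) \<in> smooth_closure"
| comp: "\<phi> \<in> smooth_closure \<Longrightarrow> smooth_real h \<Longrightarrow> (\<lambda>x. h (\<phi> x)) \<in> smooth_closure"

text \<open>Supplies the squared distance to a point, used in the bumps of
  \<open>smooth_cutoff\<close>. All coefficients are taken together because a partial derivative has
  the same form, with \<open>a\<close> replaced by 0.\<close>

lemma smooth_fun_affine_quadratic:
  "smooth_fun (\<lambda>y::'a::euclidean_space. a * (y \<bullet> y) + y \<bullet> v + c)"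
proof (rule smooth_fun_coinduct[where A="{(\<lambda>y. a * (y \<bullet> y) + y \<bullet> v + c) | a v c. True}"])
  have d: "((\<lambda>y. a * (y \<bullet> y) + y \<bullet> v + c) has_derivative (\<lambda>h. 2 * a * (x \<bullet> h) + h \<bullet> v)) (at x)"
    for a c and v x :: 'a
    by (auto intro!: derivative_eq_intros simp: inner_commute algebra_simps)
  show "\<psi> differentiable_on UNIV" if "\<psi> \<in> {(\<lambda>y::'a. a * (y \<bullet> y) + y \<bullet> v + c) | a v c. True}" for \<psi>
    using that d unfolding differentiable_on_def differentiable_def by fastforce
  show "(\<lambda>x. frechet_derivative \<psi> (at x) i) \<in> {(\<lambda>y::'a. a * (y \<bullet> y) + y \<bullet> v + c) | a v c. True}"
    if mem: "\<psi> \<in> {(\<lambda>y::'a. a * (y \<bullet> y) + y \<bullet> v + c) | a v c. True}" for \<psi> i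
  proof -
    obtain a v c where \<psi>: "\<psi> = (\<lambda>y::'a. a * (y \<bullet> y) + y \<bullet> v + c)" using mem by blast
    have "(\<lambda>x. frechet_derivative \<psi> (at x) i) = (\<lambda>x. 0 * (x \<bullet> x) + x \<bullet> ((2 * a) *\<^sub>R i) + i \<bullet> v)"
      unfolding \<psi> by (rule ext) (subst frechet_derivative_at[OF d, symmetric], simp)
    then show ?thesis by blast
  qed
qed blast

lemma smooth_fun_const: "smooth_fun (\<lambda>_::'a::euclidean_space. c)"
  using smooth_fun_affine_quadratic[of 0 0 c] by simp

lemma smooth_closure_partial:
  assumes "\<phi> \<in> smooth_closure"
  shows "(\<forall>x. \<phi> differentiable (at x)) \<and>
    (\<forall>i\<in>Basis. (\<lambda>x. frechet_derivative \<phi> (at x) i) \<in> smooth_closure)"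
  using assms
proof induction
  case (base \<phi>)
  then show ?case
    by (auto intro: smooth_fun_partial smooth_fun_differentiable smooth_closure.base)
next
  case (add \<phi> \<psi>)
  have d: "((\<lambda>x. \<phi> x + \<psi> x) has_derivative
      (\<lambda>h. frechet_derivative \<phi> (at x) h + frechet_derivative \<psi> (at x) h)) (at x)" for x
    by (intro has_derivative_add) (use add.IH frechet_derivative_works in blast)+
  then show ?case
    using add.IH by (auto simp: frechet_derivative_at[OF d, symmetric] differentiable_def
        intro!: smooth_closure.add)
next
  case (mult \<phi> \<psi>)
  have d: "((\<lambda>x. \<phi> x * \<psi> x) has_derivative
      (\<lambda>h. \<phi> x * frechet_derivative \<psi> (at x) h + frechet_derivative \<phi> (at x) h * \<psi> x)) (at x)" for x
    by (intro has_derivative_mult) (use mult.IH frechet_derivative_works in blast)+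
  then show ?case
    using mult by (auto simp: frechet_derivative_at[OF d, symmetric] differentiable_def
        intro!: smooth_closure.add smooth_closure.mult)
next
  case (inv \<phi>)
  have d: "((\<lambda>x. inverse (\<phi> x)) has_derivative
      (\<lambda>h. - (inverse (\<phi> x) * frechet_derivative \<phi> (at x) h * inverse (\<phi> x)))) (at x)" for x
    using inv.IH inv.hyps(2)[of x] frechet_derivative_works
    by (intro Deriv.has_derivative_inverse) auto
  have e: "(\<lambda>x. - (inverse (\<phi> x) * g x * inverse (\<phi> x))) \<in> smooth_closure"
    if "g \<in> smooth_closure" for g
  proof -
    \<comment> \<open>The closure has no rule for negation, so the sign enters as a constant
      factor.\<close>
    have "(\<lambda>x. (-1) * (inverse (\<phi> x) * g x * inverse (\<phi> x))) \<in> smooth_closure"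
      by (intro smooth_closure.mult smooth_closure.base smooth_fun_const that
          smooth_closure.inv inv)
    then show ?thesis by simp
  qed
  show ?case
    using inv d e by (auto simp: frechet_derivative_at[OF d, symmetric] differentiable_def)
next
  case (comp \<phi> h)
  obtain h' where h': "smooth_real h'" "\<And>x. (h has_real_derivative h' x) (at x)"
    using smooth_real_deriv comp by blast
  have d: "((\<lambda>x. h (\<phi> x)) has_derivative
      (\<lambda>y. h' (\<phi> x) * frechet_derivative \<phi> (at x) y)) (at x)" for x
    by (rule has_derivative_compose[where f=\<phi>])
       (use comp.IH frechet_derivative_works h'(2) has_field_derivative_def in blast)+
  show ?case
    using comp.IH d
    by (auto simp: frechet_derivative_at[OF d, symmetric] differentiable_def
        intro!: smooth_closure.mult smooth_closure.comp[OF comp.hyps(1) h'(1)])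
qed

lemma smooth_closure_smooth: "\<phi> \<in> smooth_closure \<Longrightarrow> smooth_fun \<phi>"
  by (rule smooth_fun_coinduct[where A=smooth_closure])
     (auto dest: smooth_closure_partial simp: differentiable_on_def intro: differentiable_at_withinI)

lemma smooth_fun_add: "smooth_fun \<phi> \<Longrightarrow> smooth_fun \<psi> \<Longrightarrow> smooth_fun (\<lambda>x. \<phi> x + \<psi> x)"
  and smooth_fun_mult: "smooth_fun \<phi> \<Longrightarrow> smooth_fun \<psi> \<Longrightarrow> smooth_fun (\<lambda>x. \<phi> x * \<psi> x)"
  and smooth_fun_inverse: "smooth_fun \<phi> \<Longrightarrow> (\<And>x. \<phi> x > 0) \<Longrightarrow> smooth_fun (\<lambda>x. inverse (\<phi> x))"
  and smooth_fun_compose: "smooth_fun \<phi> \<Longrightarrow> smooth_real h \<Longrightarrow> smooth_fun (\<lambda>x. h (\<phi> x))"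
  by (auto intro!: smooth_closure_smooth intro: smooth_closure.intros)

lemma smooth_fun_sum: "finite I \<Longrightarrow> (\<And>i. i \<in> I \<Longrightarrow> smooth_fun (\<phi> i)) \<Longrightarrow> smooth_fun (\<lambda>x. \<Sum>i\<in>I. \<phi> i x)"
  by (induction I rule: finite_induct) (simp_all add: smooth_fun_const smooth_fun_add)

text \<open>The functions \<open>t \<mapsto> p(1/t) exp (-1/t)\<close>, extended by 0, form a class closed under differentiation.\<close>
definition flat :: "real poly \<Rightarrow> real \<Rightarrow> real" where
  "flat p t = (if t > 0 then poly p (1 / t) * exp (- (1 / t)) else 0)"

lemma tendsto_poly_mult_exp_minus: "((\<lambda>y. poly p y * exp (- y)) \<longlongrightarrow> (0::real)) at_top"
proof -
  have "((\<lambda>y. \<Sum>i\<le>degree p. coeff p i * (y ^ i / exp y)) \<longlongrightarrow> (0::real)) at_top"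
    by (intro tendsto_null_sum tendsto_mult_right_zero tendsto_power_div_exp_0)
  then show ?thesis
    by (simp add: poly_altdef exp_minus sum_distrib_right divide_inverse mult.assoc)
qed

text \<open>With \<open>y = 1/t\<close> one has \<open>dy/dt = - y^2\<close>, and the derivative of
  \<open>p(y) exp(-y)\<close> in \<open>y\<close> is \<open>(p' - p)(y) exp(-y)\<close>; together
  they give the new polynomial.\<close>

lemma flat_has_derivative:
  "(flat p has_real_derivative flat ([:0, 0, 1:] * (p - pderiv p)) t) (at t)"
proof -
  consider "t > 0" | "t < 0" | "t = 0" by linarith
  then show ?thesis
  proof cases
    case 1
    have "((\<lambda>t. poly p (1 / t) * exp (- (1 / t))) has_real_derivative
        flat ([:0, 0, 1:] * (p - pderiv p)) t) (at t)"
      using 1 by (auto intro!: derivative_eq_intros simp: flat_def field_simps power2_eq_square)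
    then show ?thesis
      by (rule has_field_derivative_transform_within_open[where S="{0<..}"])
         (use 1 in \<open>auto simp: flat_def\<close>)
  next
    case 2
    have "((\<lambda>t. 0) has_real_derivative flat ([:0, 0, 1:] * (p - pderiv p)) t) (at t)"
      using 2 by (auto simp: flat_def)
    then show ?thesis
      by (rule has_field_derivative_transform_within_open[where S="{..<0}"])
         (use 2 in \<open>auto simp: flat_def\<close>)
  next
    case 3
    \<comment> \<open>The right difference quotient at 0 is \<open>y * p(y) * exp(-y)\<close> with
      \<open>y = 1/h\<close>; the extra factor \<open>y\<close> is the
      \<open>pCons 0\<close>.\<close>
    have "((\<lambda>h. poly (pCons 0 p) (inverse h) * exp (- inverse h)) \<longlongrightarrow> 0) (at_right 0)"
      by (rule filterlim_compose[OF tendsto_poly_mult_exp_minus filterlim_inverse_at_top_right])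
    then have R: "((\<lambda>h. flat p h / h) \<longlongrightarrow> 0) (at_right 0)"
    proof (rule Lim_transform_eventually)
      show "\<forall>\<^sub>F h in at_right 0. poly (pCons 0 p) (inverse h) * exp (- inverse h) = flat p h / h"
        unfolding eventually_at_right_field
        by (rule exI[of _ 1]) (auto simp: flat_def field_simps)
    qed
    have L: "((\<lambda>h. flat p h / h) \<longlongrightarrow> 0) (at_left 0)"
    proof (rule Lim_transform_eventually[OF tendsto_const])
      show "\<forall>\<^sub>F h in at_left 0. 0 = flat p h / h"
        unfolding eventually_at_left_field
        by (rule exI[of _ "-1"]) (auto simp: flat_def)
    qed
    show ?thesis
      using filterlim_split_at[OF L R] 3 by (simp add: DERIV_def flat_def)
  qed
qed

lemma smooth_real_flat: "smooth_real (flat p)"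
  unfolding smooth_real_def
  by (rule exI[of _ "\<lambda>n. flat (((\<lambda>p. [:0, 0, 1:] * (p - pderiv p)) ^^ n) p)"])
     (use flat_has_derivative in simp)

lemma flat_1_nonneg: "flat 1 t \<ge> 0"
  and flat_1_pos: "t > 0 \<Longrightarrow> flat 1 t > 0"
  and flat_1_zero: "t \<le> 0 \<Longrightarrow> flat 1 t = 0"
  by (auto simp: flat_def)

text \<open>Bumps over a finite cover of \<open>K\<close> add up to a smooth \<psi> that exceeds
  some \<open>c > 0\<close> on \<open>K\<close> and vanishes off a compact subset of
  \<open>U\<close>. The quotient \<eta> is 0 where \<psi> is 0, and 1 where \<psi> is at least
  \<open>c\<close>. The open set \<open>V\<close> is recorded because approximate limits at points
  of \<open>K\<close> depend on a neighbourhood.\<close>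

lemma smooth_cutoff:
  fixes K U :: "'a::euclidean_space set"
  assumes "compact K" "open U" "K \<subseteq> U"
  obtains \<eta> V where "test_fun U \<eta>" "\<And>x. 0 \<le> \<eta> x \<and> \<eta> x \<le> 1"
    "open V" "K \<subseteq> V" "\<And>x. x \<in> V \<Longrightarrow> \<eta> x = 1"
proof -
  have "\<exists>r>0. cball x r \<subseteq> U" if "x \<in> K" for x
    using assms that by (meson open_contains_cball subsetD)
  then obtain r where r: "\<And>x. x \<in> K \<Longrightarrow> r x > 0 \<and> cball x (r x) \<subseteq> U"
    by metis
  obtain F where F: "F \<subseteq> K" "finite F" "K \<subseteq> (\<Union>x\<in>F. ball x (r x))"
    by (rule compactE_image[OF \<open>compact K\<close>, of K "\<lambda>x. ball x (r x)"]) (use r in force)+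
  define \<psi> where "\<psi> = (\<lambda>y. \<Sum>x\<in>F. flat 1 ((r x)\<^sup>2 - (norm (y - x))\<^sup>2))"
  have sm: "smooth_fun \<psi>"
    unfolding \<psi>_def
  proof (intro smooth_fun_sum F smooth_fun_compose[OF _ smooth_real_flat])
    fix x assume "x \<in> F"
    have "(\<lambda>y. (r x)\<^sup>2 - (norm (y - x))\<^sup>2) = (\<lambda>y. (-1) * (y \<bullet> y) + y \<bullet> (2 *\<^sub>R x) + ((r x)\<^sup>2 - x \<bullet> x))"
      by (auto simp: power2_norm_eq_inner inner_diff inner_commute algebra_simps)
    then show "smooth_fun (\<lambda>y. (r x)\<^sup>2 - (norm (y - x))\<^sup>2)"
      by (simp only: smooth_fun_affine_quadratic)
  qed
  have nn: "\<psi> y \<ge> 0" for y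
    unfolding \<psi>_def by (intro sum_nonneg flat_1_nonneg)
  have out: "\<psi> y = 0" if "y \<notin> (\<Union>x\<in>F. cball x (r x))" for y
    unfolding \<psi>_def
  proof (intro sum.neutral ballI flat_1_zero)
    fix x assume x: "x \<in> F"
    then have "r x > 0" "r x < norm (y - x)" using that r F by (auto simp: dist_norm norm_minus_commute)
    then show "(r x)\<^sup>2 - (norm (y - x))\<^sup>2 \<le> 0" by simp
  qed
  have pos: "\<psi> y > 0" if y: "y \<in> K" for y
  proof -
    obtain x where x: "x \<in> F" "y \<in> ball x (r x)" using F y by blast
    then have "norm (y - x) < r x" by (auto simp: dist_norm norm_minus_commute)
    then have "(r x)\<^sup>2 - (norm (y - x))\<^sup>2 > 0" by (simp add: power_strict_mono)
    then show ?thesis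
      unfolding \<psi>_def using x F by (intro sum_pos2[of F x] flat_1_pos flat_1_nonneg)
  qed
  obtain c where c: "c > 0" "\<And>y. y \<in> K \<Longrightarrow> \<psi> y > c"
  proof (cases "K = {}")
    case False
    then obtain x0 where "x0 \<in> K" "\<And>y. y \<in> K \<Longrightarrow> \<psi> x0 \<le> \<psi> y"
      using continuous_attains_inf[OF \<open>compact K\<close> _ smooth_fun_continuous_on[OF sm]] by metis
    \<comment> \<open>Half of the minimum, so that the inequality on \<open>K\<close> is
      strict.\<close>
    then show thesis
      using that[of "\<psi> x0 / 2"] pos by (smt (verit) field_sum_of_halves)
  qed (use that[of 1] in auto)
  define \<eta> where "\<eta> = (\<lambda>y. flat 1 (\<psi> y) * inverse (flat 1 (\<psi> y) + flat 1 (c + (-1) * \<psi> y)))"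
  \<comment> \<open>Either \<open>\<psi> y > 0\<close> and the first summand is positive, or
    \<open>\<psi> y = 0 < c\<close> and the second one is.\<close>
  have den: "flat 1 (\<psi> y) + flat 1 (c + (-1) * \<psi> y) > 0" for y
    using nn[of y] c(1) flat_1_pos[of "\<psi> y"] flat_1_pos[of "c + (-1) * \<psi> y"]
      flat_1_nonneg[of "\<psi> y"] flat_1_nonneg[of "c + (-1) * \<psi> y"]
    by (cases "\<psi> y = 0") auto
  have "smooth_fun \<eta>"
    unfolding \<eta>_def
    by (intro smooth_fun_mult smooth_fun_inverse smooth_fun_add
        smooth_fun_compose[OF _ smooth_real_flat] smooth_fun_const den sm)
  moreover have "compact (\<Union>x\<in>F. cball x (r x))" "(\<Union>x\<in>F. cball x (r x)) \<subseteq> U"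
    using F r by (auto intro!: compact_UN)
  moreover have "\<eta> y = 0" if "y \<notin> (\<Union>x\<in>F. cball x (r x))" for y
    using out[OF that] by (simp add: \<eta>_def flat_1_zero)
  ultimately have 1: "test_fun U \<eta>"
    unfolding test_fun_def by blast
  have 2: "0 \<le> \<eta> y \<and> \<eta> y \<le> 1" for y
    using den[of y] flat_1_nonneg[of "\<psi> y"] flat_1_nonneg[of "c + (-1) * \<psi> y"]
    by (auto simp: \<eta>_def field_simps)
  have 3: "open {y. \<psi> y > c}"
    by (intro open_Collect_less continuous_on_const smooth_fun_continuous_on sm)
  have 4: "\<eta> y = 1" if "y \<in> {y. \<psi> y > c}" for y
    using that c flat_1_pos[of "\<psi> y"] by (auto simp: \<eta>_def flat_1_zero)
  show thesis
    by (rule that[OF 1 2 3 _ 4]) (use c in auto)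
qed

section \<open>Test functions and integration by parts\<close>

lemma grad_inner: "i \<in> Basis \<Longrightarrow> grad \<phi> x \<bullet> i = frechet_derivative \<phi> (at x) i"
  unfolding grad_def by (simp add: inner_sum_left inner_Basis if_distrib cong: if_cong)

lemma test_fun_smooth: "test_fun \<Omega> \<phi> \<Longrightarrow> smooth_fun \<phi>"
  by (simp add: test_fun_def)

lemma test_fun_zero: "test_fun \<Omega> \<phi> \<Longrightarrow> x \<notin> \<Omega> \<Longrightarrow> \<phi> x = 0"
  unfolding test_fun_def by blast

lemma test_fun_mono: "test_fun \<Omega> \<phi> \<Longrightarrow> \<Omega> \<subseteq> \<Omega>' \<Longrightarrow> test_fun \<Omega>' \<phi>"
  unfolding test_fun_def by blast

lemma test_fun_measurable [measurable_dest]: "test_fun \<Omega> \<phi> \<Longrightarrow> \<phi> \<in> borel_measurable borel"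
  by (simp add: smooth_fun_measurable test_fun_smooth)

lemma test_fun_partial:
  assumes "test_fun \<Omega> \<phi>" "i \<in> Basis"
  shows "test_fun \<Omega> (\<lambda>x. frechet_derivative \<phi> (at x) i)"
proof -
  obtain K where K: "compact K" "K \<subseteq> \<Omega>" "\<And>x. x \<notin> K \<Longrightarrow> \<phi> x = 0"
    using assms unfolding test_fun_def by blast
  have "frechet_derivative \<phi> (at x) i = 0" if "x \<notin> K" for x
  proof -
    have "(\<phi> has_derivative (\<lambda>_. 0)) (at x)"
      by (rule has_derivative_transform_within_open[where f="\<lambda>_. 0" and s="- K"])
         (use K that compact_imp_closed in auto)
    then show ?thesis
      by (metis frechet_derivative_at)
  qed
  then show ?thesis
    using K assms smooth_fun_partial unfolding test_fun_def by blast
qed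

lemma test_fun_mult:
  assumes "smooth_fun \<eta>" "test_fun \<Omega> \<phi>"
  shows "test_fun \<Omega> (\<lambda>x. \<eta> x * \<phi> x)"
  using assms smooth_fun_mult unfolding test_fun_def by (metis mult_zero_right)

lemma partial_mult:
  assumes "smooth_fun \<eta>" "smooth_fun \<phi>"
  shows "frechet_derivative (\<lambda>x. \<eta> x * \<phi> x) (at x) i =
    \<eta> x * frechet_derivative \<phi> (at x) i + frechet_derivative \<eta> (at x) i * \<phi> x"
  by (subst frechet_derivative_at[symmetric, OF has_derivative_mult])
     (use assms smooth_fun_has_derivative in auto)

lemma test_fun_bounded:
  assumes "test_fun \<Omega> \<phi>"
  obtains C where "C > 0" "\<And>x. \<bar>\<phi> x\<bar> \<le> C"
proof -
  obtain K where K: "compact K" "\<And>x. x \<notin> K \<Longrightarrow> \<phi> x = 0"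
    using assms unfolding test_fun_def by blast
  have "bounded (\<phi> ` K)"
    by (intro compact_imp_bounded compact_continuous_image K smooth_fun_continuous_on
        test_fun_smooth[OF assms])
  then obtain C where "C > 0" "\<And>x. x \<in> K \<Longrightarrow> \<bar>\<phi> x\<bar> \<le> C"
    unfolding bounded_pos by auto
  then show thesis
    using that[of C] K(2) by (metis abs_zero less_imp_le)
qed

lemma test_fun_integrable:
  assumes "test_fun \<Omega> \<phi>"
  shows "integrable lborel \<phi>"
proof -
  obtain K where K: "compact K" "\<And>x. x \<notin> K \<Longrightarrow> \<phi> x = 0"
    using assms unfolding test_fun_def by blast
  have "integrable lborel (\<lambda>x. indicator K x *\<^sub>R \<phi> x)"
    by (intro borel_integrable_compact K smooth_fun_continuous_on test_fun_smooth[OF assms])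
  moreover have "(\<lambda>x. indicator K x *\<^sub>R \<phi> x) = \<phi>"
    using K(2) by (auto simp: indicator_def fun_eq_iff)
  ultimately show ?thesis by simp
qed

lemma integral_translation:
  fixes \<phi> :: "'a::euclidean_space \<Rightarrow> real"
  assumes [measurable]: "\<phi> \<in> borel_measurable borel"
  shows "(\<integral>x. \<phi> (c + x) \<partial>lborel) = (\<integral>x. \<phi> x \<partial>lborel)"
  by (subst (2) lborel_distr_plus[of c, symmetric], subst integral_distr) auto

lemma integrable_translation:
  fixes \<phi> :: "'a::euclidean_space \<Rightarrow> real"
  assumes "integrable lborel \<phi>"
  shows "integrable lborel (\<lambda>x. \<phi> (c + x))"
proof -
  have [measurable]: "\<phi> \<in> borel_measurable borel" using assms by auto
  show ?thesis
    using assms by (subst (asm) lborel_distr_plus[of c, symmetric], subst (asm) integrable_distr_eq) auto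
qed

text \<open>The difference quotients have integral zero by translation invariance.\<close>
lemma integral_partial_test_fun:
  assumes \<psi>: "test_fun \<Omega> \<psi>" and i: "i \<in> Basis"
  shows "(\<integral>x. frechet_derivative \<psi> (at x) i \<partial>lborel) = 0"
proof -
  define h where "h n = inverse (real (Suc n))" for n
  have h: "0 < h n" "h n \<le> 1" for n
    unfolding h_def by (auto simp: field_simps)
  define d where "d n x = (\<psi> (h n *\<^sub>R i + x) - \<psi> x) / h n" for n x
  have sm: "smooth_fun \<psi>" using \<psi> by (rule test_fun_smooth)
  obtain K where K: "compact K" "\<And>x. x \<notin> K \<Longrightarrow> \<psi> x = 0"
    using \<psi> unfolding test_fun_def by blast
  then obtain R where R: "\<And>x. x \<in> K \<Longrightarrow> norm x \<le> R"
    using compact_imp_bounded bounded_iff by metis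
  obtain C where C: "C > 0" "\<And>x. \<bar>frechet_derivative \<psi> (at x) i\<bar> \<le> C"
    using test_fun_bounded[OF test_fun_partial[OF \<psi> i]] by blast
  have der: "((\<lambda>t. \<psi> (t *\<^sub>R i + x)) has_real_derivative frechet_derivative \<psi> (at (t *\<^sub>R i + x)) i) (at t)" for t x
  proof -
    have "((\<lambda>t. \<psi> (t *\<^sub>R i + x)) has_derivative (\<lambda>s. frechet_derivative \<psi> (at (t *\<^sub>R i + x)) (s *\<^sub>R i))) (at t)"
      by (rule has_derivative_compose[OF _ smooth_fun_has_derivative[OF sm]])
         (auto intro!: derivative_eq_intros)
    moreover have "frechet_derivative \<psi> (at (t *\<^sub>R i + x)) (s *\<^sub>R i) = frechet_derivative \<psi> (at (t *\<^sub>R i + x)) i * s" for s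
      using linear_cmul[OF has_derivative_linear[OF smooth_fun_has_derivative[OF sm]]]
      by (simp add: mult.commute)
    ultimately show ?thesis by (simp add: has_field_derivative_def)
  qed
  have bnd: "\<bar>d n x\<bar> \<le> C" for n x
  proof -
    obtain z where "\<psi> (h n *\<^sub>R i + x) - \<psi> (0 *\<^sub>R i + x) = (h n - 0) * frechet_derivative \<psi> (at (z *\<^sub>R i + x)) i"
      using MVT2[OF h(1)[of n], of "\<lambda>t. \<psi> (t *\<^sub>R i + x)"
          "\<lambda>t. frechet_derivative \<psi> (at (t *\<^sub>R i + x)) i"] der by blast
    then have "d n x = frechet_derivative \<psi> (at (z *\<^sub>R i + x)) i"
      using h(1)[of n] unfolding d_def by simp
    then show ?thesis using C by simp
  qed
  \<comment> \<open>Translations of length at most 1 move the support by at most 1, so one ball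
    carries the majorant for all \<open>n\<close>.\<close>
  have supp: "d n x = 0" if "x \<notin> cball 0 (R + 1)" for n x
  proof -
    have "norm (h n *\<^sub>R i) \<le> 1" using h[of n] i by simp
    then have "norm (h n *\<^sub>R i + x) > R"
      using that norm_triangle_ineq4[of "h n *\<^sub>R i + x" "h n *\<^sub>R i"] by simp
    then have "h n *\<^sub>R i + x \<notin> K" "x \<notin> K" using R that by fastforce+
    then show ?thesis by (simp add: K d_def)
  qed
  have [measurable]: "\<psi> \<in> borel_measurable borel" using \<psi> by (rule test_fun_measurable)
  have [measurable]: "(\<lambda>x. frechet_derivative \<psi> (at x) i) \<in> borel_measurable borel"
    using test_fun_partial[OF \<psi> i] by (rule test_fun_measurable)
  have "(\<lambda>n. \<integral>x. d n x \<partial>lborel) \<longlonglongrightarrow> (\<integral>x. frechet_derivative \<psi> (at x) i \<partial>lborel)"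
  proof (rule integral_dominated_convergence[where w="\<lambda>x. indicator (cball 0 (R + 1)) x *\<^sub>R C"])
    show "integrable lborel (\<lambda>x. indicator (cball 0 (R + 1)) x *\<^sub>R C :: real)"
      by (intro borel_integrable_compact) auto
    show "AE x in lborel. norm (d n x) \<le> indicator (cball 0 (R + 1)) x *\<^sub>R C" for n
    proof (rule AE_I2)
      fix x show "norm (d n x) \<le> indicator (cball 0 (R + 1)) x *\<^sub>R C"
        using bnd[of n x] supp[of x n] by (cases "x \<in> cball 0 (R + 1)") auto
    qed
    show "AE x in lborel. (\<lambda>n. d n x) \<longlonglongrightarrow> frechet_derivative \<psi> (at x) i"
    proof (rule AE_I2)
      fix x
      have D: "(\<lambda>s. (\<psi> ((0 + s) *\<^sub>R i + x) - \<psi> (0 *\<^sub>R i + x)) / s) \<midarrow>0\<rightarrow> frechet_derivative \<psi> (at (0 *\<^sub>R i + x)) i"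
        using der[of x 0] unfolding DERIV_def .
      have H: "filterlim h (at 0) sequentially"
        unfolding filterlim_at
        using LIMSEQ_inverse_real_of_nat h(1) less_imp_neq[OF h(1)] by (simp add: h_def[abs_def])
      show "(\<lambda>n. d n x) \<longlonglongrightarrow> frechet_derivative \<psi> (at x) i"
        using filterlim_compose[OF D H] by (simp add: d_def)
    qed
  qed (simp_all add: d_def)
  moreover have "(\<integral>x. d n x \<partial>lborel) = 0" for n
    unfolding d_def using integrable_translation[OF test_fun_integrable[OF \<psi>]] test_fun_integrable[OF \<psi>]
    by (simp add: integral_translation)
  ultimately show ?thesis
    by (simp add: LIMSEQ_const_iff)
qed

lemma integral_by_parts_test_fun:
  assumes \<eta>: "test_fun \<Omega> \<eta>" and \<phi>: "test_fun \<Omega> \<phi>" and i: "i \<in> Basis"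
  shows "(\<integral>x. \<eta> x * frechet_derivative \<phi> (at x) i \<partial>lborel) =
    - (\<integral>x. frechet_derivative \<eta> (at x) i * \<phi> x \<partial>lborel)"
proof -
  note sm = test_fun_smooth[OF \<eta>] test_fun_smooth[OF \<phi>]
  have "(\<integral>x. \<eta> x * frechet_derivative \<phi> (at x) i + frechet_derivative \<eta> (at x) i * \<phi> x \<partial>lborel) = 0"
    using integral_partial_test_fun[OF test_fun_mult[OF sm(1) \<phi>] i] by (simp add: partial_mult sm)
  moreover have "integrable lborel (\<lambda>x. \<eta> x * frechet_derivative \<phi> (at x) i)"
    by (rule test_fun_integrable[OF test_fun_mult[OF sm(1) test_fun_partial[OF \<phi> i]]])
  moreover have "integrable lborel (\<lambda>x. frechet_derivative \<eta> (at x) i * \<phi> x)"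
    by (rule test_fun_integrable[OF test_fun_mult[OF smooth_fun_partial[OF sm(1) i] \<phi>]])
  ultimately show ?thesis
    by simp
qed

text \<open>\<open>BV\<close> asks for one finite measure per sign, while the derivative of the
  interpolated function has a part inherited from \<open>Du\<close> and an absolutely continuous
  part. This sum merges them.\<close>

definition add_measure :: "'a::topological_space measure \<Rightarrow> 'a measure \<Rightarrow> 'a measure" where
  "add_measure \<mu> \<nu> = measure_of UNIV (sets borel) (\<lambda>A. emeasure \<mu> A + emeasure \<nu> A)"

lemma sets_add_measure [simp, measurable_cong]: "sets (add_measure \<mu> \<nu>) = sets borel"
  unfolding add_measure_def
  by (metis sets.sets_measure_of_eq space_borel)

lemma emeasure_add_measure:
  assumes s: "sets \<mu> = sets borel" "sets \<nu> = sets borel" and A: "A \<in> sets borel"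
  shows "emeasure (add_measure \<mu> \<nu>) A = emeasure \<mu> A + emeasure \<nu> A"
  unfolding add_measure_def
proof (rule emeasure_measure_of_sigma[OF _ _ _ A])
  show "sigma_algebra UNIV (sets (borel::'a measure))"
    by (metis sets.sigma_algebra_axioms space_borel)
  show "countably_additive (sets borel) (\<lambda>A. emeasure \<mu> A + emeasure \<nu> A)"
  proof (rule countably_additiveI)
    fix F :: "nat \<Rightarrow> 'a set" assume F: "range F \<subseteq> sets borel" "disjoint_family F"
    have "(\<Sum>i. emeasure \<mu> (F i)) = emeasure \<mu> (\<Union> (range F))"
      "(\<Sum>i. emeasure \<nu> (F i)) = emeasure \<nu> (\<Union> (range F))"
      using F s by (auto intro!: suminf_emeasure)
    then show "(\<Sum>i. emeasure \<mu> (F i) + emeasure \<nu> (F i)) = emeasure \<mu> (\<Union> (range F)) + emeasure \<nu> (\<Union> (range F))"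
      by (simp add: suminf_add[symmetric])
  qed
qed (simp add: positive_def)

lemma nn_integral_add_measure:
  assumes s: "sets \<mu> = sets borel" "sets \<nu> = sets borel" and f: "f \<in> borel_measurable borel"
  shows "(\<integral>\<^sup>+x. f x \<partial>add_measure \<mu> \<nu>) = (\<integral>\<^sup>+x. f x \<partial>\<mu>) + (\<integral>\<^sup>+x. f x \<partial>\<nu>)"
proof -
  note [measurable_cong] = s
  show ?thesis
    using f
  proof (induction rule: borel_measurable_induct)
    case (cong f g)
    then show ?case by (metis UNIV_I ext space_borel)
  next
    case (set A)
    then show ?case using s by (simp add: emeasure_add_measure)
  next
    case (mult u c)
    then show ?case by (simp add: nn_integral_cmult distrib_left)
  next
    case (add u v)
    then show ?case by (simp add: nn_integral_add algebra_simps)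
  next
    case (seq U)
    have m: "U i \<in> borel_measurable \<mu>" "U i \<in> borel_measurable \<nu>"
      "U i \<in> borel_measurable (add_measure \<mu> \<nu>)" for i
      using seq by auto
    have inc: "incseq (\<lambda>i. integral\<^sup>N \<mu> (U i))" "incseq (\<lambda>i. integral\<^sup>N \<nu> (U i))"
      using seq(3) by (auto simp: incseq_def le_fun_def intro!: nn_integral_mono)
    show ?case
      using seq m inc
      by (simp add: nn_integral_monotone_convergence_SUP[OF seq(3)] SUP_apply[abs_def] ennreal_SUP_add)
  qed
qed

lemma integral_add_measure:
  fixes f :: "'a::topological_space \<Rightarrow> real"
  assumes s: "sets \<mu> = sets borel" "sets \<nu> = sets borel"
    and f: "integrable \<mu> f" "integrable \<nu> f"
  shows "(\<integral>x. f x \<partial>add_measure \<mu> \<nu>) = (\<integral>x. f x \<partial>\<mu>) + (\<integral>x. f x \<partial>\<nu>)"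
proof -
  note [measurable_cong] = s
  have m: "f \<in> borel_measurable borel" 
    using borel_measurable_integrable[OF f(1)] by (simp add: measurable_cong_sets[OF s(1) refl])
  then have m': "(\<lambda>x. ennreal (f x)) \<in> borel_measurable borel" "(\<lambda>x. ennreal (- f x)) \<in> borel_measurable borel"
    by auto
  have fin: "(\<integral>\<^sup>+x. ennreal (f x) \<partial>\<mu>) < \<infinity>" "(\<integral>\<^sup>+x. ennreal (- f x) \<partial>\<mu>) < \<infinity>"
    "(\<integral>\<^sup>+x. ennreal (f x) \<partial>\<nu>) < \<infinity>" "(\<integral>\<^sup>+x. ennreal (- f x) \<partial>\<nu>) < \<infinity>"
    using f unfolding real_integrable_def by (auto simp: less_top)
  have "integrable (add_measure \<mu> \<nu>) f"
    unfolding real_integrable_def using fin m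
    by (simp add: nn_integral_add_measure[OF s m'(1)] nn_integral_add_measure[OF s m'(2)] less_top)
  then show ?thesis
    using fin
    by (simp add: real_lebesgue_integral_def f nn_integral_add_measure[OF s m'(1)]
        nn_integral_add_measure[OF s m'(2)] enn2real_plus)
qed

section \<open>Interpolating a BV function with a constant\<close>

lemma fin_meas_on_density:
  assumes s: "sets \<mu> = sets borel" and \<Omega>: "\<Omega> \<in> sets borel" and g: "integrable \<mu> g" "\<And>x. g x \<ge> 0"
    and z: "AE x in \<mu>. x \<notin> \<Omega> \<longrightarrow> g x = 0"
  shows "fin_meas_on \<Omega> (density \<mu> (\<lambda>x. ennreal (g x)))"
proof -
  note [measurable_cong] = s
  have [measurable]: "g \<in> borel_measurable \<mu>" using g by auto
  have sp: "space \<mu> = UNIV" using s sets_eq_imp_space_eq by fastforce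
  have "(\<integral>\<^sup>+x. ennreal (g x) \<partial>\<mu>) \<noteq> \<infinity>"
    using g by (simp add: nn_integral_eq_integral)
  then have "finite_measure (density \<mu> (\<lambda>x. ennreal (g x)))"
    by (intro finite_measureI) (simp add: emeasure_density sp)
  moreover have "emeasure (density \<mu> (\<lambda>x. ennreal (g x))) (UNIV - \<Omega>) = 0"
  proof -
    have "(\<integral>\<^sup>+x. ennreal (g x) * indicator (UNIV - \<Omega>) x \<partial>\<mu>) = (\<integral>\<^sup>+x. 0 \<partial>\<mu>)"
      by (rule nn_integral_cong_AE) (use z in \<open>auto simp: indicator_def\<close>)
    then show ?thesis
      using \<Omega> s by (subst emeasure_density) (auto simp: sets.compl_sets[of \<Omega> borel, simplified])
  qed
  ultimately show ?thesis
    unfolding fin_meas_on_def by (simp add: s)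
qed

lemma fin_meas_on_add_measure:
  assumes "fin_meas_on \<Omega> \<mu>" "fin_meas_on \<Omega> \<nu>" "\<Omega> \<in> sets borel"
  shows "fin_meas_on \<Omega> (add_measure \<mu> \<nu>)"
proof -
  have s: "sets \<mu> = sets borel" "sets \<nu> = sets borel" and f: "finite_measure \<mu>" "finite_measure \<nu>"
    using assms by (auto simp: fin_meas_on_def)
  have sp: "space (add_measure \<mu> \<nu>) = UNIV" using sets_eq_imp_space_eq by fastforce
  have "UNIV - \<Omega> \<in> sets borel" using assms(3) sets.compl_sets[of \<Omega> borel] by simp
  then have "emeasure (add_measure \<mu> \<nu>) (UNIV - \<Omega>) = 0"
    using assms by (simp add: emeasure_add_measure s fin_meas_on_def)
  moreover have "finite_measure (add_measure \<mu> \<nu>)"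
    using f by (intro finite_measureI) (simp add: sp emeasure_add_measure s finite_measure.emeasure_finite)
  ultimately show ?thesis
    by (simp add: fin_meas_on_def)
qed

text \<open>\<open>BV\<close> only provides Lebesgue integrability on \<Omega>, with arbitrary
  values elsewhere. A representative that is Borel on the whole space can be used in densities over
  \<open>lborel\<close>.\<close>

lemma set_integrable_lebesgue_borel_version:
  fixes u :: "'a::euclidean_space \<Rightarrow> real"
  assumes "set_integrable lebesgue \<Omega> u"
  obtains U where "integrable lborel U" "AE x in lborel. x \<in> \<Omega> \<longrightarrow> u x = U x"
proof -
  have i: "integrable lebesgue (\<lambda>x. indicator \<Omega> x *\<^sub>R u x)"
    using assms unfolding set_integrable_def .
  obtain U where U: "U \<in> borel_measurable lborel" "AE x in lborel. indicator \<Omega> x *\<^sub>R u x = U x"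
    using completion_ex_borel_measurable_real borel_measurable_integrable[OF i] by blast
  have "integrable lebesgue U"
    by (rule integrable_cong_AE_imp[OF i])
       (use U in \<open>auto intro!: measurable_completion AE_completion elim: AE_mp\<close>)
  then have "integrable lborel U" using U integrable_completion by blast
  moreover have "AE x in lborel. x \<in> \<Omega> \<longrightarrow> u x = U x"
    using U(2) by eventually_elim (auto simp: indicator_def)
  ultimately show thesis using that by blast
qed

lemma set_lebesgue_integral_eq_lborel:
  fixes g :: "'a::euclidean_space \<Rightarrow> real"
  assumes g[measurable]: "g \<in> borel_measurable borel" and \<Omega>: "\<Omega> \<in> sets borel"
    and f: "set_borel_measurable lebesgue \<Omega> f"
    and eq: "AE x in lborel. x \<in> \<Omega> \<longrightarrow> f x = g x" and z: "\<And>x. x \<notin> \<Omega> \<Longrightarrow> g x = 0"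
  shows "(LINT x:\<Omega>|lebesgue. f x) = (\<integral>x. g x \<partial>lborel)"
proof -
  have "(LINT x:\<Omega>|lebesgue. f x) = (\<integral>x. g x \<partial>lebesgue)"
    unfolding set_lebesgue_integral_def
  proof (rule integral_cong_AE)
    show "(\<lambda>x. indicator \<Omega> x *\<^sub>R f x) \<in> borel_measurable lebesgue"
      using f unfolding set_borel_measurable_def .
    show "AE x in lebesgue. indicator \<Omega> x *\<^sub>R f x = g x"
      using AE_completion[OF eq] by eventually_elim (use z in \<open>auto simp: indicator_def\<close>)
  qed (auto intro: measurable_completion)
  then show ?thesis
    by (simp add: integral_completion)
qed

text \<open>This is the weak product rule \<open>D((1 - \<eta>) u + \<eta> q) = (1 - \<eta>) Du + (q
  - u) grad \<eta> dx\<close>: the weak derivative of \<open>u\<close> is tested with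
  \<open>(1 - \<eta>) \<phi>\<close>, and the summand \<open>\<eta> q\<close> is integrated by
  parts.\<close>

lemma BV_cutoff:
  fixes u :: "'a::euclidean_space \<Rightarrow> real"
  assumes u: "BV \<Omega> u" and \<Omega>: "open \<Omega>" and \<eta>: "test_fun \<Omega> \<eta>" and \<eta>01: "\<And>x. 0 \<le> \<eta> x \<and> \<eta> x \<le> 1"
  shows "BV \<Omega> (\<lambda>x. (1 - \<eta> x) * u x + \<eta> x * q)"
  unfolding BV_def
proof (intro conjI ballI)
  have b\<Omega>: "\<Omega> \<in> sets borel" using \<Omega> by simp
  have [measurable]: "\<eta> \<in> borel_measurable borel" using \<eta> by (rule test_fun_measurable)
  have [measurable]: "\<eta> \<in> borel_measurable lebesgue" by (simp add: measurable_completion)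
  have [measurable]: "\<Omega> \<in> sets lebesgue" using b\<Omega> by simp
  have ui: "set_integrable lebesgue \<Omega> u" using u by (simp add: BV_def)
  then have [measurable]: "(\<lambda>x. indicator \<Omega> x * u x) \<in> borel_measurable lebesgue"
    unfolding set_integrable_def using borel_measurable_integrable by force
  have i1: "integrable lebesgue (\<lambda>x. (1 - \<eta> x) * (indicator \<Omega> x * u x))"
  proof (rule Bochner_Integration.integrable_bound)
    show "integrable lebesgue (\<lambda>x. indicator \<Omega> x * u x)"
      using ui by (simp add: set_integrable_def)
    show "AE x in lebesgue. norm ((1 - \<eta> x) * (indicator \<Omega> x * u x)) \<le> norm (indicator \<Omega> x * u x)"
      using \<eta>01 by (auto simp: abs_mult intro!: mult_left_le_one_le)
  qed measurable
  have i2: "integrable lebesgue (\<lambda>x. \<eta> x * q)"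
    using test_fun_integrable[OF \<eta>] by (simp add: integrable_completion)
  have ind: "indicator \<Omega> x *\<^sub>R ((1 - \<eta> x) * u x + \<eta> x * q) =
      (1 - \<eta> x) * (indicator \<Omega> x * u x) + \<eta> x * q" for x
    using test_fun_zero[OF \<eta>, of x] by (cases "x \<in> \<Omega>") auto
  show "set_integrable lebesgue \<Omega> (\<lambda>x. (1 - \<eta> x) * u x + \<eta> x * q)"
    unfolding set_integrable_def ind using i1 i2 by (rule Bochner_Integration.integrable_add)
  fix i :: 'a assume i: "i \<in> Basis"
  obtain \<mu>1 \<mu>2 where \<mu>: "fin_meas_on \<Omega> \<mu>1" "fin_meas_on \<Omega> \<mu>2"
    and D: "\<And>\<phi>. test_fun \<Omega> \<phi> \<Longrightarrow> (LINT x:\<Omega>|lebesgue. u x * (grad \<phi> x \<bullet> i)) =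
             - ((\<integral>x. \<phi> x \<partial>\<mu>1) - (\<integral>x. \<phi> x \<partial>\<mu>2))"
    using u i unfolding BV_def by meson
  obtain U where U: "integrable lborel U" "AE x in lborel. x \<in> \<Omega> \<longrightarrow> u x = U x"
    using set_integrable_lebesgue_borel_version[OF ui] by blast
  have [measurable]: "U \<in> borel_measurable borel" using U(1) by auto
  let ?d = "\<lambda>\<phi> x. frechet_derivative \<phi> (at x) i"
  have td\<eta>: "test_fun \<Omega> (?d \<eta>)" using \<eta> i by (rule test_fun_partial)
  have [measurable]: "?d \<eta> \<in> borel_measurable borel" using td\<eta> by (rule test_fun_measurable)
  have Ubd: "integrable lborel (\<lambda>x. U x * \<phi> x)" if \<phi>: "test_fun \<Omega> \<phi>" for \<phi>
  proof -
    obtain C where C: "C > 0" "\<And>x. \<bar>\<phi> x\<bar> \<le> C" using test_fun_bounded[OF \<phi>] by blast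
    have [measurable]: "\<phi> \<in> borel_measurable borel" using \<phi> by (rule test_fun_measurable)
    show ?thesis
    proof (rule Bochner_Integration.integrable_bound)
      show "integrable lborel (\<lambda>x. U x * C)" using U(1) by simp
      show "AE x in lborel. norm (U x * \<phi> x) \<le> norm (U x * C)"
        using C by (auto simp: abs_mult intro!: mult_left_mono)
    qed measurable
  qed
  \<comment> \<open>This is \<open>1 - \<eta>\<close>, written to fit \<open>smooth_fun_add\<close>
    and \<open>smooth_fun_mult\<close>.\<close>
  define \<kappa> where "\<kappa> = (\<lambda>x. 1 + (- 1) * \<eta> x)"
  have \<kappa>: "smooth_fun \<kappa>"
    unfolding \<kappa>_def by (intro smooth_fun_add smooth_fun_mult smooth_fun_const test_fun_smooth[OF \<eta>])
  have [measurable]: "\<kappa> \<in> borel_measurable borel" using \<kappa> by (rule smooth_fun_measurable)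
  have d\<kappa>: "?d \<kappa> x = - ?d \<eta> x" for x
  proof -
    have "(\<kappa> has_derivative (\<lambda>h. - frechet_derivative \<eta> (at x) h)) (at x)"
      unfolding \<kappa>_def
      by (auto intro!: derivative_eq_intros smooth_fun_has_derivative[OF test_fun_smooth[OF \<eta>]])
    then show ?thesis by (metis frechet_derivative_at)
  qed
  define w where "w = (\<lambda>x. (q - U x) * ?d \<eta> x)"
  have w: "integrable lborel w"
    using test_fun_integrable[OF td\<eta>] Ubd[OF td\<eta>] unfolding w_def by (simp add: left_diff_distrib)
  have [measurable]: "w \<in> borel_measurable borel" using w by auto
  have w0: "w x = 0" if "x \<notin> \<Omega>" for x
    using test_fun_zero[OF td\<eta> that] by (simp add: w_def)
  have s: "sets \<mu>1 = sets borel" "sets \<mu>2 = sets borel" using \<mu> by (auto simp: fin_meas_on_def)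
  note [measurable_cong] = s
  have bint: "integrable \<mu> \<phi>" if "fin_meas_on \<Omega> \<mu>" "\<phi> \<in> borel_measurable borel" "\<And>x. \<bar>\<phi> x\<bar> \<le> C"
    for \<mu> and \<phi> :: "'a \<Rightarrow> real" and C
  proof -
    interpret finite_measure \<mu> using that by (simp add: fin_meas_on_def)
    have "\<phi> \<in> borel_measurable \<mu>"
      using that by (simp add: fin_meas_on_def measurable_cong_sets[of \<mu> borel])
    then show ?thesis using that(3) by (intro integrable_const_bound[of _ C]) auto
  qed
  have \<kappa>1: "0 \<le> \<kappa> x" "\<bar>\<kappa> x\<bar> \<le> 1" for x using \<eta>01[of x] by (auto simp: \<kappa>_def)
  \<comment> \<open>Taken with \<open>w\<close> for \<open>\<mu>1\<close> and with
    \<open>- w\<close> for \<open>\<mu>2\<close>, the two measures differ by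
    \<open>\<kappa> (\<mu>1 - \<mu>2) + w dx\<close>, and both are nonnegative.\<close>
  define \<nu> where "\<nu> \<mu> v = add_measure (density \<mu> (\<lambda>x. ennreal (\<kappa> x))) (density lborel (\<lambda>x. ennreal (max 0 (v x))))"
    for \<mu> and v :: "'a \<Rightarrow> real"
  have d1: "fin_meas_on \<Omega> (density \<mu> (\<lambda>x. ennreal (\<kappa> x)))" if \<mu>: "fin_meas_on \<Omega> \<mu>" for \<mu>
  proof (rule fin_meas_on_density[OF _ b\<Omega> bint[OF \<mu>] \<kappa>1(1)])
    have "UNIV - \<Omega> \<in> null_sets \<mu>"
      using \<mu> sets.compl_sets[OF b\<Omega>] by (auto simp: fin_meas_on_def null_sets_def)
    from AE_not_in[OF this] show "AE x in \<mu>. x \<notin> \<Omega> \<longrightarrow> \<kappa> x = 0" by eventually_elim auto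
  qed (use \<mu> \<kappa>1 in \<open>auto simp: fin_meas_on_def\<close>)
  have d2: "fin_meas_on \<Omega> (density lborel (\<lambda>x. ennreal (max 0 (v x))))"
    if "integrable lborel v" "\<And>x. x \<notin> \<Omega> \<Longrightarrow> v x = 0" for v :: "'a \<Rightarrow> real"
    by (rule fin_meas_on_density[OF _ b\<Omega>]) (use that in auto)
  have \<nu>: "fin_meas_on \<Omega> (\<nu> \<mu>1 w)" "fin_meas_on \<Omega> (\<nu> \<mu>2 (\<lambda>x. - w x))"
    unfolding \<nu>_def by (intro fin_meas_on_add_measure d1 d2 \<mu> b\<Omega>; use w w0 in simp)+
  have int\<nu>: "(\<integral>x. \<phi> x \<partial>\<nu> \<mu> v) = (\<integral>x. \<kappa> x * \<phi> x \<partial>\<mu>) + (\<integral>x. max 0 (v x) * \<phi> x \<partial>lborel)"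
    if \<phi>: "test_fun \<Omega> \<phi>" and \<mu>: "fin_meas_on \<Omega> \<mu>" and v: "integrable lborel v" "\<And>x. x \<notin> \<Omega> \<Longrightarrow> v x = 0" for \<phi> \<mu> v
  proof -
    have [measurable_cong]: "sets \<mu> = sets borel" using \<mu> by (simp add: fin_meas_on_def)
    have [measurable]: "\<phi> \<in> borel_measurable borel" using \<phi> by (rule test_fun_measurable)
    have [measurable]: "v \<in> borel_measurable borel" using v by auto
    obtain C where C: "C > 0" "\<And>x. \<bar>\<phi> x\<bar> \<le> C" using test_fun_bounded[OF \<phi>] by blast
    have "(\<integral>x. \<phi> x \<partial>\<nu> \<mu> v) = (\<integral>x. \<phi> x \<partial>density \<mu> (\<lambda>x. ennreal (\<kappa> x))) +
        (\<integral>x. \<phi> x \<partial>density lborel (\<lambda>x. ennreal (max 0 (v x))))"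
      unfolding \<nu>_def
      by (rule integral_add_measure) (use C \<mu> v in \<open>auto simp: fin_meas_on_def intro!: bint d1 d2\<close>)
    then show ?thesis
      using \<kappa>1 by (simp add: integral_density)
  qed
  show "\<exists>\<mu>1 \<mu>2. fin_meas_on \<Omega> \<mu>1 \<and> fin_meas_on \<Omega> \<mu>2 \<and>
     (\<forall>\<phi>. test_fun \<Omega> \<phi> \<longrightarrow> (LINT x:\<Omega>|lebesgue. ((1 - \<eta> x) * u x + \<eta> x * q) * (grad \<phi> x \<bullet> i)) =
        - ((\<integral>x. \<phi> x \<partial>\<mu>1) - (\<integral>x. \<phi> x \<partial>\<mu>2)))"
  proof (intro exI conjI allI impI)
    show "fin_meas_on \<Omega> (\<nu> \<mu>1 w)" "fin_meas_on \<Omega> (\<nu> \<mu>2 (\<lambda>x. - w x))" by (fact \<nu>)+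
    fix \<phi> :: "'a \<Rightarrow> real" assume \<phi>: "test_fun \<Omega> \<phi>"
    have td\<phi>: "test_fun \<Omega> (?d \<phi>)" using \<phi> i by (rule test_fun_partial)
    have [measurable]: "?d \<phi> \<in> borel_measurable borel" using td\<phi> by (rule test_fun_measurable)
    have [measurable]: "?d \<phi> \<in> borel_measurable lebesgue" by (simp add: measurable_completion)
    have "test_fun \<Omega> (\<lambda>x. \<kappa> x * \<phi> x)" by (rule test_fun_mult[OF \<kappa> \<phi>])
    note t\<kappa>\<phi> = this test_fun_partial[OF this i]
    have [measurable]: "?d (\<lambda>x. \<kappa> x * \<phi> x) \<in> borel_measurable borel"
      using t\<kappa>\<phi>(2) by (rule test_fun_measurable)
    have [measurable]: "?d (\<lambda>x. \<kappa> x * \<phi> x) \<in> borel_measurable lebesgue" by (simp add: measurable_completion)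
    have td\<eta>\<phi>: "test_fun \<Omega> (\<lambda>x. ?d \<eta> x * \<phi> x)"
      by (rule test_fun_mult[OF test_fun_smooth[OF td\<eta>] \<phi>])
    have "(LINT x:\<Omega>|lebesgue. ((1 - \<eta> x) * u x + \<eta> x * q) * (grad \<phi> x \<bullet> i)) =
      (\<integral>x. ((1 - \<eta> x) * U x + \<eta> x * q) * ?d \<phi> x \<partial>lborel)"
    proof (rule set_lebesgue_integral_eq_lborel[OF _ b\<Omega>])
      have "indicator \<Omega> x *\<^sub>R (((1 - \<eta> x) * u x + \<eta> x * q) * (grad \<phi> x \<bullet> i)) =
        ((1 - \<eta> x) * (indicator \<Omega> x * u x) + \<eta> x * q) * ?d \<phi> x" for x
        using ind[of x] by (simp add: grad_inner[OF i] mult.assoc[symmetric])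
      then show "set_borel_measurable lebesgue \<Omega> (\<lambda>x. ((1 - \<eta> x) * u x + \<eta> x * q) * (grad \<phi> x \<bullet> i))"
        unfolding set_borel_measurable_def by simp
      show "AE x in lborel. x \<in> \<Omega> \<longrightarrow> ((1 - \<eta> x) * u x + \<eta> x * q) * (grad \<phi> x \<bullet> i) =
          ((1 - \<eta> x) * U x + \<eta> x * q) * ?d \<phi> x"
        using U(2) by eventually_elim (simp add: grad_inner[OF i])
    qed (use test_fun_zero[OF td\<phi>] in auto)
    \<comment> \<open>By \<open>d\<kappa> = - d\<eta>\<close> one has
      \<open>\<kappa> d\<phi> = d(\<kappa> \<phi>) + d\<eta> \<phi>\<close>; the weak derivative of
      \<open>u\<close> applies to the term with \<open>d(\<kappa> \<phi>)\<close>.\<close>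
    also have "\<dots> = (\<integral>x. U x * ?d (\<lambda>x. \<kappa> x * \<phi> x) x + U x * (?d \<eta> x * \<phi> x) + q * (\<eta> x * ?d \<phi> x) \<partial>lborel)"
      by (intro Bochner_Integration.integral_cong refl)
         (simp only: partial_mult[OF \<kappa> test_fun_smooth[OF \<phi>]] d\<kappa>, simp add: \<kappa>_def algebra_simps)
    also have "\<dots> = (\<integral>x. U x * ?d (\<lambda>x. \<kappa> x * \<phi> x) x \<partial>lborel) + (\<integral>x. U x * (?d \<eta> x * \<phi> x) \<partial>lborel)
        + q * (\<integral>x. \<eta> x * ?d \<phi> x \<partial>lborel)"
      using Ubd[OF t\<kappa>\<phi>(2)] Ubd[OF td\<eta>\<phi>]
        test_fun_integrable[OF test_fun_mult[OF test_fun_smooth[OF \<eta>] td\<phi>]] by simp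
    also have "(\<integral>x. \<eta> x * ?d \<phi> x \<partial>lborel) = - (\<integral>x. ?d \<eta> x * \<phi> x \<partial>lborel)"
      by (rule integral_by_parts_test_fun[OF \<eta> \<phi> i])
    also have "(\<integral>x. U x * ?d (\<lambda>x. \<kappa> x * \<phi> x) x \<partial>lborel) =
        (LINT x:\<Omega>|lebesgue. u x * (grad (\<lambda>x. \<kappa> x * \<phi> x) x \<bullet> i))"
    proof (rule set_lebesgue_integral_eq_lborel[OF _ b\<Omega>, symmetric])
      show "set_borel_measurable lebesgue \<Omega> (\<lambda>x. u x * (grad (\<lambda>x. \<kappa> x * \<phi> x) x \<bullet> i))"
        unfolding set_borel_measurable_def by (simp add: grad_inner[OF i] mult.assoc[symmetric])
      show "AE x in lborel. x \<in> \<Omega> \<longrightarrow> u x * (grad (\<lambda>x. \<kappa> x * \<phi> x) x \<bullet> i) = U x * ?d (\<lambda>x. \<kappa> x * \<phi> x) x"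
        using U(2) by eventually_elim (simp add: grad_inner[OF i])
    qed (use test_fun_zero[OF t\<kappa>\<phi>(2)] in auto)
    also have "\<dots> = - ((\<integral>x. \<kappa> x * \<phi> x \<partial>\<mu>1) - (\<integral>x. \<kappa> x * \<phi> x \<partial>\<mu>2))"
      by (rule D[OF t\<kappa>\<phi>(1)])
    finally have L: "(LINT x:\<Omega>|lebesgue. ((1 - \<eta> x) * u x + \<eta> x * q) * (grad \<phi> x \<bullet> i)) =
        - ((\<integral>x. \<kappa> x * \<phi> x \<partial>\<mu>1) - (\<integral>x. \<kappa> x * \<phi> x \<partial>\<mu>2)) + (\<integral>x. U x * (?d \<eta> x * \<phi> x) \<partial>lborel)
        + q * - (\<integral>x. ?d \<eta> x * \<phi> x \<partial>lborel)" .
    obtain C where C: "C > 0" "\<And>x. \<bar>\<phi> x\<bar> \<le> C" using test_fun_bounded[OF \<phi>] by blast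
    have [measurable]: "\<phi> \<in> borel_measurable borel" using \<phi> by (rule test_fun_measurable)
    have mi: "integrable lborel (\<lambda>x. max 0 (v x) * \<phi> x)" if v: "integrable lborel v" for v :: "'a \<Rightarrow> real"
    proof (rule Bochner_Integration.integrable_bound)
      show "integrable lborel (\<lambda>x. max 0 (v x) * C)" using v by simp
      show "AE x in lborel. norm (max 0 (v x) * \<phi> x) \<le> norm (max 0 (v x) * C)"
        using C by (auto simp: abs_mult intro!: mult_left_mono)
    qed (use v in auto)
    have "(\<integral>x. max 0 (w x) * \<phi> x \<partial>lborel) - (\<integral>x. max 0 (- w x) * \<phi> x \<partial>lborel) =
        (\<integral>x. max 0 (w x) * \<phi> x - max 0 (- w x) * \<phi> x \<partial>lborel)"
      using mi[OF w] mi[of "\<lambda>x. - w x"] w by simp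
    also have "\<dots> = (\<integral>x. q * (?d \<eta> x * \<phi> x) - U x * (?d \<eta> x * \<phi> x) \<partial>lborel)"
    proof (intro Bochner_Integration.integral_cong refl)
      fix x
      have "max 0 (w x) * \<phi> x - max 0 (- w x) * \<phi> x = w x * \<phi> x"
        by (auto simp: max_def)
      then show "max 0 (w x) * \<phi> x - max 0 (- w x) * \<phi> x = q * (?d \<eta> x * \<phi> x) - U x * (?d \<eta> x * \<phi> x)"
        by (simp add: w_def algebra_simps)
    qed
    also have "\<dots> = q * (\<integral>x. ?d \<eta> x * \<phi> x \<partial>lborel) - (\<integral>x. U x * (?d \<eta> x * \<phi> x) \<partial>lborel)"
      using Ubd[OF td\<eta>\<phi>] test_fun_integrable[OF td\<eta>\<phi>] by simp
    finally show "(LINT x:\<Omega>|lebesgue. ((1 - \<eta> x) * u x + \<eta> x * q) * (grad \<phi> x \<bullet> i)) =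
        - ((\<integral>x. \<phi> x \<partial>\<nu> \<mu>1 w) - (\<integral>x. \<phi> x \<partial>\<nu> \<mu>2 (\<lambda>x. - w x)))"
      using L w w0 by (simp add: int\<nu>[OF \<phi> \<mu>(1)] int\<nu>[OF \<phi> \<mu>(2)])
  qed
qed

section \<open>Points of density\<close>

lemma lmeasurable_ball_Int [intro]: "A \<in> sets lebesgue \<Longrightarrow> ball x r \<inter> A \<in> lmeasurable"
  by (metis fmeasurable_Int_fmeasurable inf_commute lmeasurable_ball)

text \<open>Clearing the denominator once lets density zero be handled by plain inequalities between
  measures.\<close>

lemma dens_zero_if_ratio_le:
  assumes "\<And>e. e > 0 \<Longrightarrow> \<exists>d>0. \<forall>r. 0 < r \<and> r < d \<longrightarrow>
    measure lebesgue (ball x r \<inter> A) \<le> e * measure lebesgue (ball x r)"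
  shows "dens_zero A x"
  unfolding dens_zero_def
proof (rule tendstoI)
  fix e :: real assume e: "e > 0"
  then obtain d where d: "d > 0" "\<And>r. 0 < r \<Longrightarrow> r < d \<Longrightarrow>
      measure lebesgue (ball x r \<inter> A) \<le> e / 2 * measure lebesgue (ball x r)"
    using assms[of "e / 2"] by auto
  show "\<forall>\<^sub>F r in at_right 0. dist (measure lebesgue (ball x r \<inter> A) / measure lebesgue (ball x r)) 0 < e"
    unfolding eventually_at_right_field
  proof (intro exI[of _ d] conjI allI impI d)
    fix r assume "r > 0" "r < d"
    then have "measure lebesgue (ball x r \<inter> A) / measure lebesgue (ball x r) \<le> e / 2"
      using d(2)[of r] content_ball_pos[of r x] by (simp add: divide_le_eq)
    also have "\<dots> < e" using e by simp
    finally show "dist (measure lebesgue (ball x r \<inter> A) / measure lebesgue (ball x r)) 0 < e"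
      by simp
  qed
qed

lemma dens_zero_ratio_le:
  assumes "dens_zero A x" "e > 0"
  shows "\<exists>d>0. \<forall>r. 0 < r \<and> r < d \<longrightarrow>
    measure lebesgue (ball x r \<inter> A) \<le> e * measure lebesgue (ball x r)"
proof -
  obtain d where d: "d > 0" "\<And>r. 0 < r \<Longrightarrow> r < d \<Longrightarrow>
      dist (measure lebesgue (ball x r \<inter> A) / measure lebesgue (ball x r)) 0 < e"
    using tendstoD[OF assms(1)[unfolded dens_zero_def] assms(2)] unfolding eventually_at_right_field by blast
  show ?thesis
  proof (intro exI[of _ d] conjI allI impI d)
    fix r assume "0 < r \<and> r < d"
    then show "measure lebesgue (ball x r \<inter> A) \<le> e * measure lebesgue (ball x r)"
      using d(2)[of r] content_ball_pos[of r x] by (simp add: field_simps)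
  qed
qed

text \<open>Lebesgue's density theorem: a Vitali cover of the exceptional set by balls inside a tight
  open neighbourhood of the complement of A.\<close>
lemma AE_dens_zero:
  fixes A :: "'a::euclidean_space set"
  assumes A: "A \<in> sets lebesgue"
  shows "AE x in lebesgue. x \<notin> A \<longrightarrow> dens_zero A x"
proof -
  define D where "D \<epsilon> = {x. x \<notin> A \<and> (\<forall>d>0. \<exists>r. 0 < r \<and> r < d \<and>
    measure lebesgue (ball x r \<inter> A) > \<epsilon> * measure lebesgue (ball x r))}" for \<epsilon> :: real
  have neg: "negligible (D \<epsilon>)" if \<epsilon>: "\<epsilon> > 0" for \<epsilon>
    unfolding negligible_outer_le
  proof (intro allI impI)
    fix e :: real assume e: "e > 0"
    have "- A \<in> sets lebesgue" using A by (simp add: sets.compl_sets Compl_in_sets_lebesgue)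
    \<comment> \<open>The set \<open>U - - A\<close> is \<open>U \<inter> A\<close>. Disjoint balls
      inside \<open>U\<close> in which \<open>A\<close> fills more than the fraction \<epsilon> have
      total measure at most \<open>1 / \<epsilon>\<close> times that of \<open>U \<inter> A\<close>,
      so the bound \<open>e * \<epsilon>\<close> leads to \<open>e\<close>.\<close>
    then obtain U where U: "open U" "- A \<subseteq> U" "U - - A \<in> lmeasurable" "emeasure lebesgue (U - - A) < ennreal (e * \<epsilon>)"
      using sets_lebesgue_outer_open[of "- A" "e * \<epsilon>"] e \<epsilon> by (auto simp: mult_pos_pos)
    define K where "K = {(x, r). x \<in> D \<epsilon> \<and> 0 < r \<and> ball x r \<subseteq> U \<and>
      measure lebesgue (ball x r \<inter> A) > \<epsilon> * measure lebesgue (ball x r)}"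
    have cov: "\<exists>i. i \<in> K \<and> x \<in> ball (fst i) (snd i) \<and> snd i < d" if x: "x \<in> D \<epsilon>" and d: "0 < d" for x d
    proof -
      have "x \<in> U" using x U(2) by (auto simp: D_def)
      then obtain s where s: "s > 0" "ball x s \<subseteq> U" using U(1) open_contains_ball by blast
      then obtain r where r: "0 < r" "r < min d s" "measure lebesgue (ball x r \<inter> A) > \<epsilon> * measure lebesgue (ball x r)"
        using x d unfolding D_def mem_Collect_eq by (meson min_less_iff_conj)
      have "ball x r \<subseteq> U" using s r by (meson min_less_iff_conj less_imp_le subset_ball subset_trans)
      then have "(x, r) \<in> K" using x r by (simp add: K_def)
      then show ?thesis using r by (intro exI[of _ "(x, r)"]) auto
    qed
    obtain C where C: "countable C" "C \<subseteq> K"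
      "pairwise (\<lambda>i j. disjnt (ball (fst i) (snd i)) (ball (fst j) (snd j))) C"
      "negligible (D \<epsilon> - (\<Union>i\<in>C. ball (fst i) (snd i)))"
      using Vitali_covering_theorem_balls[of "D \<epsilon>" K fst snd] cov by blast
    let ?B = "\<lambda>i. ball (fst i) (snd i :: real) :: 'a set"
    have dis: "disjoint_family_on ?B C" "disjoint_family_on (\<lambda>i. ?B i \<inter> A) C"
      using C(3) by (force simp: disjoint_family_on_def pairwise_def disjnt_def)+
    have "emeasure lebesgue (\<Union>i\<in>C. ?B i) = (\<integral>\<^sup>+i. emeasure lebesgue (?B i) \<partial>count_space C)"
      by (rule emeasure_UN_countable) (use C dis in auto)
    also have "\<dots> \<le> (\<integral>\<^sup>+i. ennreal (1 / \<epsilon>) * emeasure lebesgue (?B i \<inter> A) \<partial>count_space C)"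
    proof (rule nn_integral_mono)
      fix i assume "i \<in> space (count_space C)"
      then have "i \<in> K" using C by auto
      then have "measure lebesgue (?B i) \<le> (1 / \<epsilon>) * measure lebesgue (?B i \<inter> A)"
        using \<epsilon> by (auto simp: K_def field_simps)
      then show "emeasure lebesgue (?B i) \<le> ennreal (1 / \<epsilon>) * emeasure lebesgue (?B i \<inter> A)"
        using \<epsilon> A by (simp add: emeasure_eq_measure2 lmeasurable_ball lmeasurable_ball_Int ennreal_mult[symmetric] ennreal_leI)
    qed
    also have "\<dots> = ennreal (1 / \<epsilon>) * emeasure lebesgue (\<Union>i\<in>C. ?B i \<inter> A)"
      by (subst emeasure_UN_countable) (use C dis A in \<open>auto simp: nn_integral_cmult\<close>)
    also have "\<dots> \<le> ennreal (1 / \<epsilon>) * emeasure lebesgue (U - - A)"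
    proof (intro mult_left_mono emeasure_mono)
      have "?B i \<subseteq> U" if "i \<in> C" for i
        using subsetD[OF C(2) that] by (auto simp: K_def split_beta)
      then show "(\<Union>i\<in>C. ?B i \<inter> A) \<subseteq> U - - A" by blast
      show "U - - A \<in> sets lebesgue" using U(3) by (rule fmeasurableD)
    qed simp
    also have "\<dots> \<le> ennreal (1 / \<epsilon>) * ennreal (e * \<epsilon>)"
      using U(4) by (intro mult_left_mono) auto
    also have "\<dots> = ennreal e"
      using \<epsilon> e by (simp add: ennreal_mult[symmetric])
    finally have le: "emeasure lebesgue (\<Union>i\<in>C. ?B i) \<le> ennreal e" .
    have ms: "(\<Union>i\<in>C. ?B i) \<in> lmeasurable"
      using le C(1) by (intro fmeasurableI sets.countable_UN') (auto simp: le_less_trans[OF _ ennreal_less_top])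
    show "\<exists>T. D \<epsilon> \<subseteq> T \<and> T \<in> lmeasurable \<and> measure lebesgue T \<le> e"
    proof (intro exI conjI)
      let ?N = "D \<epsilon> - (\<Union>i\<in>C. ?B i)"
      show "D \<epsilon> \<subseteq> (\<Union>i\<in>C. ?B i) \<union> ?N" by blast
      show "(\<Union>i\<in>C. ?B i) \<union> ?N \<in> lmeasurable"
        using fmeasurable.Un[OF ms negligible_imp_measurable[OF C(4)]] .
      have "measure lebesgue ((\<Union>i\<in>C. ?B i) \<union> ?N) \<le> measure lebesgue (\<Union>i\<in>C. ?B i) + measure lebesgue ?N"
        using ms C(4) by (intro measure_Un_le) (auto simp: negligible_imp_sets fmeasurableD)
      also have "\<dots> \<le> e"
        using le C(4) ms e by (simp add: negligible_imp_measure0 emeasure_eq_measure2 ennreal_le_iff)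
      finally show "measure lebesgue ((\<Union>i\<in>C. ?B i) \<union> ?N) \<le> e" .
    qed
  qed
  have "negligible (\<Union>k. D (1 / real (Suc k)))"
    by (intro negligible_countable_Union) (auto intro: neg)
  then have "AE x in lebesgue. x \<notin> (\<Union>k. D (1 / real (Suc k)))"
    unfolding negligible_iff_null_sets by (rule AE_not_in)
  then show ?thesis
  proof (eventually_elim, intro impI dens_zero_if_ratio_le)
    fix x and e :: real assume x: "x \<notin> (\<Union>k. D (1 / real (Suc k)))" "x \<notin> A" and e: "e > 0"
    obtain k where k: "1 / real (Suc k) < e" using nat_approx_posE[OF e] .
    have "x \<notin> D (1 / real (Suc k))" using x by blast
    then obtain d where d: "d > 0" "\<And>r. 0 < r \<Longrightarrow> r < d \<Longrightarrow>
        measure lebesgue (ball x r \<inter> A) \<le> 1 / real (Suc k) * measure lebesgue (ball x r)"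
      using x(2) unfolding D_def mem_Collect_eq by (meson not_less)
    show "\<exists>d>0. \<forall>r. 0 < r \<and> r < d \<longrightarrow> measure lebesgue (ball x r \<inter> A) \<le> e * measure lebesgue (ball x r)"
    proof (intro exI[of _ d] conjI allI impI d)
      fix r assume "0 < r \<and> r < d"
      then have "measure lebesgue (ball x r \<inter> A) \<le> 1 / real (Suc k) * measure lebesgue (ball x r)"
        using d by blast
      also have "\<dots> \<le> e * measure lebesgue (ball x r)"
        using k by (intro mult_right_mono) auto
      finally show "measure lebesgue (ball x r \<inter> A) \<le> e * measure lebesgue (ball x r)" .
    qed
  qed
qed

text \<open>The value 0 that \<open>measure\<close> assigns to non-measurable sets would break
  monotonicity if \<open>B\<close> were not measurable; hence measurability is carried along with
  the level sets.\<close>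

lemma dens_zero_mono:
  assumes "dens_zero B x" "A \<subseteq> B" "A \<in> sets lebesgue" "B \<in> sets lebesgue"
  shows "dens_zero A x"
proof (rule dens_zero_if_ratio_le)
  fix e :: real assume "e > 0"
  have le: "measure lebesgue (ball x r \<inter> A) \<le> measure lebesgue (ball x r \<inter> B)" for r
    using assms by (intro measure_mono_fmeasurable) auto
  show "\<exists>d>0. \<forall>r. 0 < r \<and> r < d \<longrightarrow> measure lebesgue (ball x r \<inter> A) \<le> e * measure lebesgue (ball x r)"
    using dens_zero_ratio_le[OF assms(1) \<open>e > 0\<close>] le order_trans by meson
qed

lemma dens_zero_Un:
  assumes "dens_zero A x" "dens_zero B x" "A \<in> sets lebesgue" "B \<in> sets lebesgue"
  shows "dens_zero (A \<union> B) x"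
proof (rule dens_zero_if_ratio_le)
  fix e :: real assume "e > 0"
  then obtain d d' where d: "d > 0" "\<And>r. 0 < r \<Longrightarrow> r < d \<Longrightarrow>
      measure lebesgue (ball x r \<inter> A) \<le> e / 2 * measure lebesgue (ball x r)"
    and d': "d' > 0" "\<And>r. 0 < r \<Longrightarrow> r < d' \<Longrightarrow>
      measure lebesgue (ball x r \<inter> B) \<le> e / 2 * measure lebesgue (ball x r)"
    using dens_zero_ratio_le[OF assms(1), of "e / 2"] dens_zero_ratio_le[OF assms(2), of "e / 2"] by auto
  show "\<exists>d>0. \<forall>r. 0 < r \<and> r < d \<longrightarrow> measure lebesgue (ball x r \<inter> (A \<union> B)) \<le> e * measure lebesgue (ball x r)"
  proof (intro exI[of _ "min d d'"] conjI allI impI)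
    fix r assume r: "0 < r \<and> r < min d d'"
    have "measure lebesgue (ball x r \<inter> (A \<union> B)) \<le> measure lebesgue (ball x r \<inter> A) + measure lebesgue (ball x r \<inter> B)"
      unfolding Int_Un_distrib using assms by (intro measure_Un_le) (auto intro: fmeasurableD)
    also have "\<dots> \<le> e / 2 * measure lebesgue (ball x r) + e / 2 * measure lebesgue (ball x r)"
      using d d' r by (intro add_mono) auto
    finally show "measure lebesgue (ball x r \<inter> (A \<union> B)) \<le> e * measure lebesgue (ball x r)"
      by simp
  qed (use d d' in auto)
qed

lemma dens_zero_null:
  assumes "A \<in> null_sets lebesgue"
  shows "dens_zero A x"
proof -
  have "measure lebesgue (ball x r \<inter> A) = 0" for r
    using assms null_set_Int1[of A lebesgue "ball x r"] by (simp add: Int_commute measure_eq_0_null_sets)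
  then show ?thesis by (simp add: dens_zero_def)
qed

lemma dens_zero_local:
  assumes "d > 0" "ball x d \<inter> A = ball x d \<inter> B" "dens_zero A x"
  shows "dens_zero B x"
proof (rule dens_zero_if_ratio_le)
  fix e :: real assume "e > 0"
  then obtain d' where d': "d' > 0" "\<And>r. 0 < r \<Longrightarrow> r < d' \<Longrightarrow>
      measure lebesgue (ball x r \<inter> A) \<le> e * measure lebesgue (ball x r)"
    using dens_zero_ratio_le[OF assms(3)] by blast
  have "ball x r \<inter> A = ball x r \<inter> B" if "r < d" for r
    using assms(2) subset_ball[of r d x] that by auto
  then have "measure lebesgue (ball x r \<inter> B) \<le> e * measure lebesgue (ball x r)" if "0 < r" "r < min d d'" for r
    using d'(2)[of r] that by simp
  then show "\<exists>d>0. \<forall>r. 0 < r \<and> r < d \<longrightarrow> measure lebesgue (ball x r \<inter> B) \<le> e * measure lebesgue (ball x r)"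
    using d'(1) assms(1) by (intro exI[of _ "min d d'"]) simp
qed

text \<open>Two sets that cover \<Omega> cannot both have density zero at a point of \<Omega>. This
  bounds the levels in \<open>ap_upper\<close> from below and puts the two approximate limits in
  order.\<close>

lemma not_dens_zero_open:
  assumes "open \<Omega>" "x \<in> \<Omega>"
  shows "\<not> dens_zero \<Omega> x"
proof
  assume "dens_zero \<Omega> x"
  then obtain d where d: "d > 0" "\<And>r. 0 < r \<Longrightarrow> r < d \<Longrightarrow>
      measure lebesgue (ball x r \<inter> \<Omega>) \<le> 1 / 2 * measure lebesgue (ball x r)"
    using dens_zero_ratio_le[of \<Omega> x "1 / 2"] by auto
  obtain s where s: "s > 0" "ball x s \<subseteq> \<Omega>" using assms open_contains_ball by blast
  define r where "r = min d s / 2"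
  have r: "r > 0" "r < d" "r \<le> s" using d s by (auto simp: r_def)
  then have "ball x r \<inter> \<Omega> = ball x r" using s subset_ball[of r s x] by blast
  then show False
    using d(2)[OF r(1,2)] content_ball_pos[OF r(1), of x] by simp
qed

text \<open>Up to a null set \<open>A\<close> is Borel, and then the value at \<open>x\<close> is
  the measure of the section at \<open>x\<close> of a Borel set in the product space, which depends
  measurably on \<open>x\<close>.\<close>

lemma borel_measurable_measure_ball_Int:
  fixes A :: "'a::euclidean_space set"
  assumes A: "A \<in> sets lebesgue"
  shows "(\<lambda>x. measure lebesgue (ball x r \<inter> A)) \<in> borel_measurable borel"
proof -
  let ?S = "main_part lborel A"
  have S: "?S \<in> sets borel" using A main_part_sets[of A lborel] by simp
  have "emeasure lebesgue (ball x r \<inter> A) = emeasure lborel (ball x r \<inter> ?S)" for x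
  proof -
    have "emeasure lebesgue (ball x r \<inter> A) = emeasure lebesgue (ball x r \<inter> ?S)"
    proof (rule emeasure_eq_AE)
      show "AE y in lebesgue. (y \<in> ball x r \<inter> A) = (y \<in> ball x r \<inter> ?S)"
        using AE_completion[OF AE_in_main_part[OF A]] by eventually_elim auto
    qed (use A S in auto)
    then show ?thesis using S by simp
  qed
  moreover have "(\<lambda>x. emeasure lborel (Pair x -` {p. dist (fst p) (snd p) < r \<and> snd p \<in> ?S})) \<in> borel_measurable borel"
  proof (rule lborel.measurable_emeasure_Pair)
    have "{p \<in> space (borel \<Otimes>\<^sub>M borel). dist (fst p) (snd p) < r \<and> snd p \<in> ?S} \<in> sets (borel \<Otimes>\<^sub>M borel)"
      using S by measurable
    then show "{p. dist (fst p) (snd p) < r \<and> snd p \<in> ?S} \<in> sets (borel \<Otimes>\<^sub>M lborel)"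
      by (simp add: space_pair_measure cong: sets_pair_measure_cong)
  qed
  moreover have "Pair x -` {p. dist (fst p) (snd p) < r \<and> snd p \<in> ?S} = ball x r \<inter> ?S" for x
    by auto
  ultimately show ?thesis
    by (simp add: measure_def)
qed

text \<open>Uncountably many radii are reduced to rational ones: between \<open>r\<close> and
  \<open>2 * r\<close> lies a rational \<open>s\<close>, and enlarging the ball from radius
  \<open>r\<close> to \<open>s\<close> costs at most the volume ratio \<open>2 ^ DIM('a)\<close>.
  That the set is Borel, even for a Lebesgue measurable \<open>A\<close>, is what integration
  against \<sigma> requires.\<close>

lemma sets_dens_zero:
  fixes A :: "'a::euclidean_space set"
  assumes A: "A \<in> sets lebesgue"
  shows "{x. dens_zero A x} \<in> sets borel"
proof -
  define c where "c = (\<lambda>r. measure lebesgue (ball (0::'a) r))"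
  have tr: "measure lebesgue (ball x r) = c r" for x :: 'a and r
    using measure_translation[of x "ball 0 r"] by (simp add: c_def)
  have iff: "dens_zero A x \<longleftrightarrow> (\<forall>k::nat. \<exists>m::nat. \<forall>r::rat. 0 < r \<and> r < 1 / of_nat (Suc m) \<longrightarrow>
      measure lebesgue (ball x (of_rat r) \<inter> A) \<le> 1 / real (Suc k) * c (of_rat r))" for x
  proof
    assume L: "dens_zero A x"
    show "\<forall>k::nat. \<exists>m::nat. \<forall>r::rat. 0 < r \<and> r < 1 / of_nat (Suc m) \<longrightarrow>
      measure lebesgue (ball x (of_rat r) \<inter> A) \<le> 1 / real (Suc k) * c (of_rat r)"
    proof
      fix k
      obtain d where d: "d > 0" "\<And>r. 0 < r \<Longrightarrow> r < d \<Longrightarrow>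
          measure lebesgue (ball x r \<inter> A) \<le> 1 / real (Suc k) * measure lebesgue (ball x r)"
        using dens_zero_ratio_le[OF L, of "1 / real (Suc k)"] by auto
      obtain m where m: "1 / real (Suc m) < d" using nat_approx_posE[OF d(1)] .
      have "of_rat r < d" if "r < 1 / of_nat (Suc m)" for r
      proof -
        have "(of_rat r :: real) < of_rat (1 / of_nat (Suc m))" using that by (simp only: of_rat_less)
        then show ?thesis using m by (simp add: of_rat_divide of_rat_add)
      qed
      then show "\<exists>m::nat. \<forall>r::rat. 0 < r \<and> r < 1 / of_nat (Suc m) \<longrightarrow>
          measure lebesgue (ball x (of_rat r) \<inter> A) \<le> 1 / real (Suc k) * c (of_rat r)"
        using d(2) by (auto simp: tr intro!: exI[of _ m])
    qed
  next
    assume R: "\<forall>k::nat. \<exists>m::nat. \<forall>r::rat. 0 < r \<and> r < 1 / of_nat (Suc m) \<longrightarrow>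
      measure lebesgue (ball x (of_rat r) \<inter> A) \<le> 1 / real (Suc k) * c (of_rat r)"
    show "dens_zero A x"
    proof (rule dens_zero_if_ratio_le)
      fix e :: real assume e: "e > 0"
      let ?N = "2 ^ DIM('a) :: real"
      obtain k where k: "1 / real (Suc k) < e / ?N" using nat_approx_posE[of "e / ?N"] e by auto
      obtain m where m: "\<And>r::rat. 0 < r \<Longrightarrow> r < 1 / of_nat (Suc m) \<Longrightarrow>
          measure lebesgue (ball x (of_rat r) \<inter> A) \<le> 1 / real (Suc k) * c (of_rat r)"
        using R by blast
      show "\<exists>d>0. \<forall>r. 0 < r \<and> r < d \<longrightarrow> measure lebesgue (ball x r \<inter> A) \<le> e * measure lebesgue (ball x r)"
      proof (intro exI[of _ "1 / (2 * real (Suc m))"] conjI allI impI)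
        fix r assume r: "0 < r \<and> r < 1 / (2 * real (Suc m))"
        then obtain s where s: "r < of_rat s" "of_rat s < 2 * r"
          using of_rat_dense[of r "2 * r"] by auto
        have s0: "0 < s" using r s by (metis less_trans zero_less_of_rat_iff)
        have "2 * r < 1 / real (Suc m)" using r by (simp add: field_simps)
        then have "(of_rat s :: real) < 1 / real (Suc m)" using s by linarith
        also have "\<dots> = of_rat (1 / of_nat (Suc m))" by (simp add: of_rat_divide of_rat_add)
        finally have s1: "s < 1 / of_nat (Suc m)" by (simp only: of_rat_less)
        have "measure lebesgue (ball x r \<inter> A) \<le> measure lebesgue (ball x (of_rat s) \<inter> A)"
          using s A subset_ball[of r "of_rat s" x] by (intro measure_mono_fmeasurable) auto
        also have "\<dots> \<le> 1 / real (Suc k) * c (of_rat s)" by (rule m[OF s0 s1])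
        also have "\<dots> \<le> e / ?N * c (2 * r)"
          unfolding c_def using k s e subset_ball[of "of_rat s" "2 * r" "0::'a"]
          by (intro mult_mono measure_mono_fmeasurable) auto
        also have "c (2 * r) = ?N * c r"
          using r content_ball_conv_unit_ball[of "2 * r" "0::'a"] content_ball_conv_unit_ball[of r "0::'a"]
          by (simp add: c_def power_mult_distrib)
        finally show "measure lebesgue (ball x r \<inter> A) \<le> e * measure lebesgue (ball x r)"
          by (simp add: tr)
      qed simp
    qed
  qed
  have [measurable]: "(\<lambda>x. measure lebesgue (ball x r \<inter> A)) \<in> borel_measurable borel" for r
    using A by (rule borel_measurable_measure_ball_Int)
  have "{x \<in> space borel. dens_zero A x} \<in> sets borel"
    unfolding iff by measurable
  then show ?thesis by simp
qed

section \<open>Approximate limits\<close>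

text \<open>Holds without hypotheses, because \<open>Inf\<close> on the reals is defined as minus
  the \<open>Sup\<close> of the negated set, so that default values on empty or unbounded sets agree
  as well.\<close>

lemma ap_lower_eq_ap_upper_uminus: "ap_lower \<Omega> u x = - ap_upper \<Omega> (\<lambda>y. - u y) x"
proof -
  have "{t. dens_zero {y \<in> \<Omega>. u y < t} x} = uminus ` {t. dens_zero {y \<in> \<Omega>. - u y > t} x}"
  proof (intro set_eqI iffI)
    fix t assume "t \<in> {t. dens_zero {y \<in> \<Omega>. u y < t} x}"
    then show "t \<in> uminus ` {t. dens_zero {y \<in> \<Omega>. - u y > t} x}"
      by (intro image_eqI[of _ _ "- t"]) auto
  next
    fix t assume "t \<in> uminus ` {t. dens_zero {y \<in> \<Omega>. - u y > t} x}"
    moreover have "- u y > s \<longleftrightarrow> u y < - s" for s y by linarith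
    ultimately show "t \<in> {t. dens_zero {y \<in> \<Omega>. u y < t} x}"
      by auto
  qed
  then show ?thesis
    by (simp add: ap_lower_def ap_upper_def Inf_real_def image_image)
qed

lemma ap_upper_cong_local:
  assumes d: "d > 0" and eq: "\<And>y. y \<in> ball x d \<Longrightarrow> u y = v y"
  shows "ap_upper \<Omega> u x = ap_upper \<Omega> v x"
proof -
  have "ball x d \<inter> {y \<in> \<Omega>. u y > t} = ball x d \<inter> {y \<in> \<Omega>. v y > t}" for t
    using eq by auto
  then have "dens_zero {y \<in> \<Omega>. u y > t} x \<longleftrightarrow> dens_zero {y \<in> \<Omega>. v y > t} x" for t
    using dens_zero_local[OF d] by metis
  then show ?thesis by (simp add: ap_upper_def)
qed

lemma ap_lower_cong_local:
  assumes "d > 0" "\<And>y. y \<in> ball x d \<Longrightarrow> u y = v y"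
  shows "ap_lower \<Omega> u x = ap_lower \<Omega> v x"
  unfolding ap_lower_eq_ap_upper_uminus
  using ap_upper_cong_local[OF assms(1), of x "\<lambda>y. - u y" "\<lambda>y. - v y"] assms(2) by simp

lemma ap_upper_const:
  assumes "open \<Omega>" "x \<in> \<Omega>"
  shows "ap_upper \<Omega> (\<lambda>_. q) x = q"
proof -
  have "dens_zero {y \<in> \<Omega>. q > t} x \<longleftrightarrow> q \<le> t" for t
    using not_dens_zero_open[OF assms] dens_zero_null[of "{}" x] by (cases "q > t") auto
  then have "{t. dens_zero {y \<in> \<Omega>. q > t} x} = {q..}" by auto
  then show ?thesis by (simp add: ap_upper_def)
qed

lemma ap_lower_const:
  assumes "open \<Omega>" "x \<in> \<Omega>"
  shows "ap_lower \<Omega> (\<lambda>_. q) x = q"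
  unfolding ap_lower_eq_ap_upper_uminus by (simp add: ap_upper_const[OF assms])

text \<open>The essential bound makes the set of levels in \<open>ap_upper\<close> nonempty and
  bounded below at every point of \<Omega>, so the infimum there is a genuine one and not a default
  value.\<close>

locale ess_bounded =
  fixes \<Omega> :: "'a::euclidean_space set" and u :: "'a \<Rightarrow> real" and C :: real
  assumes open_dom: "open \<Omega>"
    and meas: "set_borel_measurable lebesgue \<Omega> u"
    and bound: "AE x in lebesgue. x \<in> \<Omega> \<longrightarrow> \<bar>u x\<bar> \<le> C"
begin

lemma uminus: "ess_bounded \<Omega> (\<lambda>x. - u x) C"
proof
  show "set_borel_measurable lebesgue \<Omega> (\<lambda>x. - u x)"
    using borel_measurable_uminus[OF meas[unfolded set_borel_measurable_def]]
    by (simp add: set_borel_measurable_def)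
qed (use open_dom bound in auto)

lemma sets_superlevel: "{y \<in> \<Omega>. u y > t} \<in> sets lebesgue"
  and sets_sublevel_eq: "{y \<in> \<Omega>. u y \<le> t} \<in> sets lebesgue"
proof -
  have m: "(\<lambda>x. indicator \<Omega> x *\<^sub>R u x) \<in> borel_measurable lebesgue"
    using meas unfolding set_borel_measurable_def .
  have o: "\<Omega> \<in> sets lebesgue" using open_dom by simp
  have "{y \<in> space lebesgue. indicator \<Omega> y *\<^sub>R u y > t} \<in> sets lebesgue"
    "{y \<in> space lebesgue. indicator \<Omega> y *\<^sub>R u y \<le> t} \<in> sets lebesgue"
    using m by measurable
  then have "\<Omega> \<inter> {y \<in> space lebesgue. indicator \<Omega> y *\<^sub>R u y > t} \<in> sets lebesgue"
    "\<Omega> \<inter> {y \<in> space lebesgue. indicator \<Omega> y *\<^sub>R u y \<le> t} \<in> sets lebesgue"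
    using o by (auto intro: sets.Int)
  moreover have "\<Omega> \<inter> {y \<in> space lebesgue. indicator \<Omega> y *\<^sub>R u y > t} = {y \<in> \<Omega>. u y > t}"
    "\<Omega> \<inter> {y \<in> space lebesgue. indicator \<Omega> y *\<^sub>R u y \<le> t} = {y \<in> \<Omega>. u y \<le> t}"
    by auto
  ultimately show "{y \<in> \<Omega>. u y > t} \<in> sets lebesgue" "{y \<in> \<Omega>. u y \<le> t} \<in> sets lebesgue"
    by simp_all
qed

lemma null_above: "t \<ge> C \<Longrightarrow> {y \<in> \<Omega>. u y > t} \<in> null_sets lebesgue"
proof -
  assume t: "t \<ge> C"
  have "AE x in lebesgue. x \<notin> {y \<in> \<Omega>. u y > t}"
    using bound by eventually_elim (use t in auto)
  then show ?thesis using sets_superlevel by (simp add: AE_iff_null_sets)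
qed

lemma null_below: "t < - C \<Longrightarrow> {y \<in> \<Omega>. u y \<le> t} \<in> null_sets lebesgue"
proof -
  assume t: "t < - C"
  have "AE x in lebesgue. x \<notin> {y \<in> \<Omega>. u y \<le> t}"
    using bound by eventually_elim (use t in auto)
  then show ?thesis using sets_sublevel_eq by (simp add: AE_iff_null_sets)
qed

lemma dens_zero_upward:
  "dens_zero {y \<in> \<Omega>. u y > s} x \<Longrightarrow> s \<le> t \<Longrightarrow> dens_zero {y \<in> \<Omega>. u y > t} x"
  by (erule dens_zero_mono) (auto intro: sets_superlevel)

lemma dens_zero_superlevel_ge:
  assumes x: "x \<in> \<Omega>" and t: "dens_zero {y \<in> \<Omega>. u y > t} x"
  shows "- C \<le> t"
proof (rule ccontr)
  assume "\<not> - C \<le> t"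
  then have "dens_zero {y \<in> \<Omega>. u y \<le> t} x" by (intro dens_zero_null null_below) simp
  from dens_zero_Un[OF t this sets_superlevel sets_sublevel_eq]
  have "dens_zero ({y \<in> \<Omega>. u y > t} \<union> {y \<in> \<Omega>. u y \<le> t}) x" .
  moreover have "{y \<in> \<Omega>. u y > t} \<union> {y \<in> \<Omega>. u y \<le> t} = \<Omega>" by auto
  ultimately show False using not_dens_zero_open[OF open_dom x] by simp
qed

lemma bdd_below_levels: "x \<in> \<Omega> \<Longrightarrow> bdd_below {t. dens_zero {y \<in> \<Omega>. u y > t} x}"
  by (intro bdd_belowI[of _ "- C"]) (auto intro: dens_zero_superlevel_ge)

lemma levels_ne: "C \<in> {t. dens_zero {y \<in> \<Omega>. u y > t} x}"
  by (simp add: dens_zero_null null_above)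

lemma ap_upper_le: "x \<in> \<Omega> \<Longrightarrow> dens_zero {y \<in> \<Omega>. u y > t} x \<Longrightarrow> ap_upper \<Omega> u x \<le> t"
  unfolding ap_upper_def by (rule cInf_lower) (auto intro: bdd_below_levels)

text \<open>Density zero persists when the level is raised, so rational levels suffice and the
  condition becomes a countable union, which gives Borel measurability.\<close>

lemma ap_upper_less_iff:
  assumes "x \<in> \<Omega>"
  shows "ap_upper \<Omega> u x < s \<longleftrightarrow> (\<exists>t::rat. of_rat t < s \<and> dens_zero {y \<in> \<Omega>. u y > of_rat t} x)"
proof
  assume "ap_upper \<Omega> u x < s"
  then obtain t where t: "dens_zero {y \<in> \<Omega>. u y > t} x" "t < s"
    using cInf_less_iff[OF _ bdd_below_levels[OF assms]] levels_ne unfolding ap_upper_def by blast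
  obtain r where "t < of_rat r" "of_rat r < s" using of_rat_dense[OF t(2)] by blast
  then show "\<exists>t::rat. of_rat t < s \<and> dens_zero {y \<in> \<Omega>. u y > of_rat t} x"
    using dens_zero_upward[OF t(1)] by auto
qed (use ap_upper_le[OF assms] in fastforce)

lemma ap_upper_bounded: "x \<in> \<Omega> \<Longrightarrow> \<bar>ap_upper \<Omega> u x\<bar> \<le> C"
proof -
  assume x: "x \<in> \<Omega>"
  have "- C \<le> ap_upper \<Omega> u x"
    unfolding ap_upper_def
    by (rule cInf_greatest) (use levels_ne dens_zero_superlevel_ge[OF x] in auto)
  moreover have "ap_upper \<Omega> u x \<le> C"
    using ap_upper_le[OF x] levels_ne by blast
  ultimately show ?thesis by simp
qed

lemma ap_upper_measurable: "(\<lambda>x. indicator \<Omega> x * ap_upper \<Omega> u x) \<in> borel_measurable borel"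
proof -
  have "ap_upper \<Omega> u \<in> borel_measurable (restrict_space borel \<Omega>)"
  proof (rule borel_measurableI_less)
    fix s
    have "{x \<in> space (restrict_space borel \<Omega>). ap_upper \<Omega> u x < s} =
      \<Omega> \<inter> (\<Union>t\<in>{t::rat. of_rat t < s}. {x. dens_zero {y \<in> \<Omega>. u y > of_rat t} x})"
      using ap_upper_less_iff by (auto simp: space_restrict_space)
    moreover have "(\<Union>t\<in>{t::rat. of_rat t < s}. {x. dens_zero {y \<in> \<Omega>. u y > of_rat t} x}) \<in> sets borel"
      by (intro sets.countable_UN'' sets_dens_zero sets_superlevel) auto
    ultimately show "{x \<in> space (restrict_space borel \<Omega>). ap_upper \<Omega> u x < s} \<in> sets (restrict_space borel \<Omega>)"
      by (auto simp: sets_restrict_space)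
  qed
  then show ?thesis
    using open_dom by (subst (asm) borel_measurable_restrict_space_iff) auto
qed

lemma ap_lower_bounded: "x \<in> \<Omega> \<Longrightarrow> \<bar>ap_lower \<Omega> u x\<bar> \<le> C"
  using ess_bounded.ap_upper_bounded[OF uminus] by (simp add: ap_lower_eq_ap_upper_uminus)

lemma ap_lower_measurable: "(\<lambda>x. indicator \<Omega> x * ap_lower \<Omega> u x) \<in> borel_measurable borel"
  using borel_measurable_uminus[OF ess_bounded.ap_upper_measurable[OF uminus]]
  by (simp add: ap_lower_eq_ap_upper_uminus)

lemma ap_lower_ge:
  assumes "x \<in> \<Omega>" "dens_zero {y \<in> \<Omega>. u y < t} x"
  shows "t \<le> ap_lower \<Omega> u x"
proof -
  have "{y \<in> \<Omega>. - u y > - t} = {y \<in> \<Omega>. u y < t}" by auto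
  then have "ap_upper \<Omega> (\<lambda>y. - u y) x \<le> - t"
    using ess_bounded.ap_upper_le[OF uminus assms(1), of "- t"] assms(2) by simp
  then show ?thesis by (simp add: ap_lower_eq_ap_upper_uminus)
qed

text \<open>In the wrong order there would be levels \<open>s < m < - t\<close> such that
  \<open>{u > s}\<close> and \<open>{u < - t}\<close> both have density zero, although they cover
  \<Omega>.\<close>

lemma ap_lower_le_ap_upper:
  assumes x: "x \<in> \<Omega>"
  shows "ap_lower \<Omega> u x \<le> ap_upper \<Omega> u x"
proof (rule ccontr)
  assume "\<not> ap_lower \<Omega> u x \<le> ap_upper \<Omega> u x"
  then have lt: "ap_upper \<Omega> u x < ap_lower \<Omega> u x" by simp
  define m where "m = (ap_upper \<Omega> u x + ap_lower \<Omega> u x) / 2"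
  have "ap_upper \<Omega> u x < m" "ap_upper \<Omega> (\<lambda>y. - u y) x < - m"
    using lt by (auto simp: m_def ap_lower_eq_ap_upper_uminus field_simps)
  then obtain s t where st: "s < m" "dens_zero {y \<in> \<Omega>. u y > s} x"
      "t < - m" "dens_zero {y \<in> \<Omega>. - u y > t} x"
    unfolding ap_upper_less_iff[OF x] ess_bounded.ap_upper_less_iff[OF uminus x] by blast
  have "dens_zero ({y \<in> \<Omega>. u y > s} \<union> {y \<in> \<Omega>. - u y > t}) x"
    by (intro dens_zero_Un st sets_superlevel ess_bounded.sets_superlevel[OF uminus])
  moreover have "{y \<in> \<Omega>. u y > s} \<union> {y \<in> \<Omega>. - u y > t} = \<Omega>" using st by auto
  ultimately show False using not_dens_zero_open[OF open_dom x] by simp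
qed

text \<open>By the density theorem almost every point of \<Omega> is a point of density zero of
  \<open>{u < q}\<close> or of \<open>{u \<ge> q}\<close>, whichever does not contain it. In the
  first case \<open>q \<le> u^-\<close>, in the second \<open>u^+ \<le> q\<close>.\<close>

lemma AE_not_between: "AE x in lebesgue. x \<in> \<Omega> \<longrightarrow> \<not> (ap_lower \<Omega> u x < q \<and> q < ap_upper \<Omega> u x)"
proof -
  have "{y \<in> \<Omega>. u y < q} = {y \<in> \<Omega>. - u y > - q}" "{y \<in> \<Omega>. u y \<ge> q} = {y \<in> \<Omega>. - u y \<le> - q}" by auto
  then have s: "{y \<in> \<Omega>. u y < q} \<in> sets lebesgue" "{y \<in> \<Omega>. u y \<ge> q} \<in> sets lebesgue"
    using ess_bounded.sets_superlevel[OF uminus, of "- q"] ess_bounded.sets_sublevel_eq[OF uminus, of "- q"]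
    by simp_all
  show ?thesis
    using AE_dens_zero[OF s(1)] AE_dens_zero[OF s(2)]
  proof eventually_elim
    case (elim x)
    show ?case
    proof (intro impI)
      assume x: "x \<in> \<Omega>"
      show "\<not> (ap_lower \<Omega> u x < q \<and> q < ap_upper \<Omega> u x)"
      proof (cases "u x < q")
        case True
        then have "dens_zero {y \<in> \<Omega>. u y \<ge> q} x" using elim by auto
        then have "dens_zero {y \<in> \<Omega>. u y > q} x"
          by (rule dens_zero_mono) (use s sets_superlevel in auto)
        then show ?thesis using ap_upper_le[OF x] by force
      next
        case False
        then have "dens_zero {y \<in> \<Omega>. u y < q} x" using elim by auto
        then show ?thesis using ap_lower_ge[OF x] by force
      qed
    qed
  qed
qed

end

section \<open>Primitives in the second variable\<close>

lemma LBINT_eq_cases: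
  fixes h :: "real \<Rightarrow> 'b::{banach, second_countable_topology}" and t :: real
  shows "(LBINT s=0..t. h s) = (if 0 \<le> t then (\<integral>s. indicator {0<..<t} s *\<^sub>R h s \<partial>lborel)
    else - (\<integral>s. indicator {t<..<0} s *\<^sub>R h s \<partial>lborel))"
  by (simp add: interval_lebesgue_integral_def set_lebesgue_integral_def zero_ereal_def)

lemma interval_primitive_measurable:
  fixes g :: "'a::euclidean_space \<Rightarrow> real \<Rightarrow> 'b::{banach, second_countable_topology}"
  assumes g: "(\<lambda>(x, t). g x t) \<in> borel_measurable borel"
  shows "(\<lambda>p::'a \<times> real. LBINT s=0..ereal (snd p). g (fst p) s) \<in> borel_measurable (borel \<Otimes>\<^sub>M borel)"
proof -
  have g': "(\<lambda>p. g (fst p) (snd p)) \<in> borel_measurable (borel \<Otimes>\<^sub>M borel)"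
    using g by (simp add: borel_prod split_beta')
  have [measurable]: "(\<lambda>p. g (fst (fst p)) (snd p)) \<in> borel_measurable ((borel \<Otimes>\<^sub>M borel) \<Otimes>\<^sub>M lborel)"
    by (rule measurable_compose[OF _ g', of "\<lambda>p. (fst (fst p), snd p)", simplified]) measurable
  \<comment> \<open>The interval of integration depends on the parameter, so it is moved into the
    integrand before measurability of parameter integrals applies.\<close>
  have "(\<lambda>p::'a \<times> real. \<integral>s. (if 0 < s \<and> s < snd p then g (fst p) s else 0) \<partial>lborel) \<in> borel_measurable (borel \<Otimes>\<^sub>M borel)"
    "(\<lambda>p::'a \<times> real. \<integral>s. (if snd p < s \<and> s < 0 then g (fst p) s else 0) \<partial>lborel) \<in> borel_measurable (borel \<Otimes>\<^sub>M borel)"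
    by (intro lborel.borel_measurable_lebesgue_integral; simp add: split_beta')+
  then have [measurable]: "(\<lambda>p::'a \<times> real. \<integral>s. indicator {0<..<snd p} s *\<^sub>R g (fst p) s \<partial>lborel) \<in> borel_measurable (borel \<Otimes>\<^sub>M borel)"
    "(\<lambda>p::'a \<times> real. \<integral>s. indicator {snd p<..<0} s *\<^sub>R g (fst p) s \<partial>lborel) \<in> borel_measurable (borel \<Otimes>\<^sub>M borel)"
    by (simp_all add: indicator_def if_distrib[of "\<lambda>c. c *\<^sub>R _"] cong: if_cong)
  show ?thesis
    unfolding LBINT_eq_cases by measurable
qed

lemma interval_integral_bound:
  fixes h :: "real \<Rightarrow> 'b::{banach, second_countable_topology}"
  assumes h: "h \<in> borel_measurable borel" and M: "AE s in lborel. norm (h s) \<le> M"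
  shows "interval_lebesgue_integrable lborel (ereal a) (ereal c) h"
    and "norm (LBINT s=a..c. h s) \<le> M * \<bar>c - a\<bar>"
proof -
  have c: "integrable lborel (\<lambda>s. indicator {a<..<c} s *\<^sub>R M)" for a c :: real
    by (cases "a \<le> c") (simp_all add: integrable_real_indicator)
  have i: "integrable lborel (\<lambda>s. indicator {a<..<c} s *\<^sub>R h s)" for a c
  proof (rule Bochner_Integration.integrable_bound)
    show "integrable lborel (\<lambda>s. indicator {a<..<c} s *\<^sub>R M)" by (rule c)
    show "AE s in lborel. norm (indicator {a<..<c} s *\<^sub>R h s) \<le> norm (indicator {a<..<c} s *\<^sub>R M)"
      using M by eventually_elim (auto simp: indicator_def)
  qed (use h in measurable)
  have n: "norm (\<integral>s. indicator {a<..<c} s *\<^sub>R h s \<partial>lborel) \<le> M * (c - a)" if "a \<le> c" for a c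
  proof -
    have "norm (\<integral>s. indicator {a<..<c} s *\<^sub>R h s \<partial>lborel) \<le> (\<integral>s. norm (indicator {a<..<c} s *\<^sub>R h s) \<partial>lborel)"
      by (rule integral_norm_bound)
    also have "\<dots> \<le> (\<integral>s. indicator {a<..<c} s *\<^sub>R M \<partial>lborel)"
    proof (rule integral_mono_AE)
      show "AE s in lborel. norm (indicator {a<..<c} s *\<^sub>R h s) \<le> indicator {a<..<c} s *\<^sub>R M"
        using M by eventually_elim (auto simp: indicator_def)
    qed (use integrable_norm[OF i] c in blast)+
    also have "\<dots> = M * (c - a)" using that by simp
    finally show ?thesis .
  qed
  show "interval_lebesgue_integrable lborel (ereal a) (ereal c) h"
    using i by (simp add: interval_lebesgue_integrable_def set_integrable_def)
  show "norm (LBINT s=a..c. h s) \<le> M * \<bar>c - a\<bar>"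
    using n[of a c] n[of c a] by (auto simp: interval_lebesgue_integral_def set_lebesgue_integral_def)
qed

lemma interval_primitive_continuous:
  fixes h :: "real \<Rightarrow> real"
  assumes h: "h \<in> borel_measurable borel" and M: "AE s in lborel. norm (h s) \<le> M"
  shows "continuous_on UNIV (\<lambda>t::real. LBINT s=0..t. h s)"
proof -
  \<comment> \<open>A Lipschitz constant must be nonnegative. The almost everywhere bound holds at
    some point, as \<open>lborel\<close> is not the zero measure.\<close>
  have M0: "M \<ge> 0"
  proof -
    have "AE s::real in lborel. 0 \<le> M" using M by eventually_elim (meson norm_ge_zero order_trans)
    then show ?thesis by (simp add: eventually_const_iff ae_filter_eq_bot_iff)
  qed
  have "dist (LBINT s=0..c. h s) (LBINT s=0..a. h s) \<le> M * dist c a" for a c :: real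
  proof -
    have "(LBINT s=0..a. h s) + (LBINT s=a..c. h s) = (LBINT s=0..c. h s)"
      unfolding zero_ereal_def
    proof (rule interval_integral_sum)
      show "interval_lebesgue_integrable lborel (min (ereal 0) (min (ereal a) (ereal c)))
          (max (ereal 0) (max (ereal a) (ereal c))) h"
        using interval_integral_bound(1)[OF h M, of "min 0 (min a c)" "max 0 (max a c)"]
        by (simp only: ereal_min ereal_max)
    qed
    then have "(LBINT s=0..c. h s) - (LBINT s=0..a. h s) = (LBINT s=a..c. h s)" by simp
    then show ?thesis using interval_integral_bound(2)[OF h M, of a c] by (simp add: dist_real_def)
  qed
  then have "M-lipschitz_on UNIV (\<lambda>t::real. LBINT s=0..t. h s)"
    using M0 by (intro lipschitz_onI)
  then show ?thesis by (rule lipschitz_on_continuous_on)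
qed

text \<open>Over the set where \<open>\<bar>f\<bar> > 1\<close> the hypothesis makes the integral of
  \<open>\<bar>f\<bar> - 1\<close> at most 0, while the integrand is positive there.\<close>

lemma AE_norm_le_1_of_density_le:
  assumes s: "sets \<sigma> = sets borel" and f: "integrable \<sigma> (f :: _ \<Rightarrow> real)" and fin: "finite_measure \<sigma>"
    and le: "meas_le (density \<sigma> (\<lambda>x. ennreal \<bar>f x\<bar>)) \<sigma>"
  shows "AE x in \<sigma>. \<bar>f x\<bar> \<le> 1"
proof -
  interpret finite_measure \<sigma> by fact
  have [measurable]: "f \<in> borel_measurable \<sigma>" using f by auto
  define A where "A = {x \<in> space \<sigma>. \<bar>f x\<bar> > 1}"
  have A [measurable]: "A \<in> sets \<sigma>" unfolding A_def by measurable
  have i: "integrable \<sigma> (\<lambda>x. \<bar>f x\<bar> * indicator A x)"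
    using f by (intro integrable_real_mult_indicator) auto
  have iA: "integrable \<sigma> (indicator A :: _ \<Rightarrow> real)"
    by (rule integrable_real_indicator) (auto simp: less_top[symmetric])
  have "ennreal (\<integral>x. \<bar>f x\<bar> * indicator A x \<partial>\<sigma>) = (\<integral>\<^sup>+x. ennreal (\<bar>f x\<bar> * indicator A x) \<partial>\<sigma>)"
    using i by (intro nn_integral_eq_integral[symmetric]) auto
  also have "\<dots> = emeasure (density \<sigma> (\<lambda>x. ennreal \<bar>f x\<bar>)) A"
    by (subst emeasure_density) (auto intro!: nn_integral_cong simp: indicator_def)
  also have "\<dots> \<le> emeasure \<sigma> A" using le A s by (auto simp: meas_le_def)
  finally have "(\<integral>x. \<bar>f x\<bar> * indicator A x \<partial>\<sigma>) \<le> measure \<sigma> A"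
    by (simp add: emeasure_eq_measure)
  then have "(\<integral>x. (\<bar>f x\<bar> - 1) * indicator A x \<partial>\<sigma>) \<le> 0"
    using i iA A by (simp add: left_diff_distrib)
  moreover have nn: "AE x in \<sigma>. 0 \<le> (\<bar>f x\<bar> - 1) * indicator A x"
    by (auto simp: indicator_def A_def)
  ultimately have "(\<integral>x. (\<bar>f x\<bar> - 1) * indicator A x \<partial>\<sigma>) = 0"
    using integral_nonneg_AE[OF nn] by linarith
  moreover have "integrable \<sigma> (\<lambda>x. (\<bar>f x\<bar> - 1) * indicator A x)"
    using i iA A by (simp add: left_diff_distrib)
  ultimately have "AE x in \<sigma>. (\<bar>f x\<bar> - 1) * indicator A x = 0"
    using integral_nonneg_eq_0_iff_AE nn by blast
  then show ?thesis
    using AE_space by eventually_elim (auto simp: A_def indicator_def split: if_splits)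
qed

text \<open>By continuity a violation inside the interval would be an open condition and hence occur
  at a rational; the endpoints follow by closure.\<close>

lemma Fhat_eq_if_rational_le:
  assumes cont: "continuous_on UNIV (Fprim f x)" and w: "a \<le> w" "w \<le> c"
    and le: "\<And>r::rat. a < of_rat r \<Longrightarrow> of_rat r < c \<Longrightarrow> Fprim f x (of_rat r) \<le> Fprim f x w"
  shows "Fprim f x w = Fhat f x a c"
proof -
  have le': "Fprim f x t \<le> Fprim f x w" if t: "t \<in> {a..c}" for t
  proof (cases "a = c")
    \<comment> \<open>The open interval is empty here, so its closure would miss the point.\<close>
    case True
    then show ?thesis using w t by simp
  next
    case False
    then have ac: "a < c" using w by simp
    have cl: "closed {t. Fprim f x t \<le> Fprim f x w}"
      using cont by (intro closed_Collect_le) (auto simp: continuous_on_const)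
    have "{a<..<c} \<subseteq> {t. Fprim f x t \<le> Fprim f x w}"
    proof
      fix s assume s: "s \<in> {a<..<c}"
      show "s \<in> {t. Fprim f x t \<le> Fprim f x w}"
      proof (rule ccontr)
        assume "s \<notin> {t. Fprim f x t \<le> Fprim f x w}"
        then have "s \<in> - {t. Fprim f x t \<le> Fprim f x w} \<inter> {a<..<c}" using s by blast
        moreover have "open (- {t. Fprim f x t \<le> Fprim f x w} \<inter> {a<..<c})"
          using cl by (intro open_Int) auto
        ultimately obtain e where e: "e > 0" "ball s e \<subseteq> - {t. Fprim f x t \<le> Fprim f x w} \<inter> {a<..<c}"
          using open_contains_ball by blast
        obtain r where r: "s < of_rat r" "of_rat r < s + e" using of_rat_dense[of s "s + e"] e by auto
        then have "of_rat r \<in> ball s e" by (auto simp: dist_real_def)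
        then have "of_rat r \<in> - {t. Fprim f x t \<le> Fprim f x w} \<inter> {a<..<c}" using e by blast
        then show False using le[of r] by auto
      qed
    qed
    then have "closure {a<..<c} \<subseteq> {t. Fprim f x t \<le> Fprim f x w}"
      using cl closure_minimal by blast
    then show ?thesis using t ac by auto
  qed
  show ?thesis
    unfolding Fhat_def using w le' by (intro antisym cSUP_upper cSUP_least bdd_aboveI2) auto
qed

section \<open>Necessity of the maximum condition\<close>

theorem theorem8p10:
  fixes \<Omega> :: "'a::euclidean_space set"
    and b :: "'a \<Rightarrow> real \<Rightarrow> 'a"
    and \<sigma> :: "'a measure"
    and f :: "'a \<Rightarrow> real \<Rightarrow> real"
    and lam :: "'a \<Rightarrow> real"
    and u :: "'a \<Rightarrow> real"
  assumes dim: "DIM('a) \<ge> 2"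
    and open_\<Omega>: "open \<Omega>"
    \<comment> \<open>(b1)\<close>
    and b1_meas: "(\<lambda>(x, t). b x t) \<in> borel_measurable borel"
    and b1_bdd: "\<exists>M. \<forall>x\<in>\<Omega>. \<forall>t. norm (b x t) \<le> M"
    \<comment> \<open>(b2)\<close>
    and b2: "AE x in lebesgue. x \<in> \<Omega> \<longrightarrow> continuous_on UNIV (b x)"
    \<comment> \<open>(b3),(b4): sigma finite Radon measure on Omega, div_x b_t = f(.,t) sigma\<close>
    and \<sigma>_fin: "fin_meas_on \<Omega> \<sigma>"
    and f_meas: "(\<lambda>(x, t). f x t) \<in> borel_measurable borel"
    and f_int: "\<And>t. integrable \<sigma> (\<lambda>x. f x t)"
    and div_b: "\<And>t \<phi>. test_fun \<Omega> \<phi> \<Longrightarrow>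
        (LINT x:\<Omega>|lebesgue. b x t \<bullet> grad \<phi> x) = - (\<integral>x. \<phi> x * f x t \<partial>\<sigma>)"
    \<comment> \<open>(b4): sigma is the least upper bound of the total variations |div_x b_t| = |f(.,t)| sigma\<close>
    and \<sigma>_ub: "\<And>t. meas_le (density \<sigma> (\<lambda>x. ennreal \<bar>f x t\<bar>)) \<sigma>"
    and \<sigma>_least: "\<And>\<nu>. sets \<nu> = sets borel \<Longrightarrow>
        (\<forall>t. meas_le (density \<sigma> (\<lambda>x. ennreal \<bar>f x t\<bar>)) \<nu>) \<Longrightarrow> meas_le \<sigma> \<nu>"
    \<comment> \<open>lambda and u\<close>
    and lam_meas: "lam \<in> borel_measurable (restrict_space borel \<Omega>)"
    and lam_range: "\<And>x. x \<in> \<Omega> \<Longrightarrow> 0 \<le> lam x \<and> lam x \<le> 1"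
    and u_BV: "BV \<Omega> u"
    and u_Linf: "Linf \<Omega> u"
    \<comment> \<open>lower semicontinuity along A(u)\<close>
    and lsc: "\<And>us \<phi>. adm_seq \<Omega> \<sigma> u us \<Longrightarrow> test_fun \<Omega> \<phi> \<Longrightarrow> (\<forall>x. \<phi> x \<ge> 0) \<Longrightarrow>
        ereal (pairing_lam \<Omega> \<sigma> b f lam u \<phi>)
          \<le> liminf (\<lambda>n. ereal (pairing_lam \<Omega> \<sigma> b f lam (us n) \<phi>))"
  shows "AE x in \<sigma>. Fprim f x (u_lam \<Omega> lam u x)
           = Fhat f x (ap_lower \<Omega> u x) (ap_upper \<Omega> u x)"
proof -

  \<comment> \<open>Bounds and measurability for the primitives and the approximate limits\<close>
  have s\<sigma> [measurable_cong]: "sets \<sigma> = sets borel" and fin\<sigma>: "finite_measure \<sigma>"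
    and out\<sigma>: "emeasure \<sigma> (UNIV - \<Omega>) = 0"
    using \<sigma>_fin by (auto simp: fin_meas_on_def)
  interpret \<sigma>: finite_measure \<sigma> by fact
  have b\<Omega> [measurable]: "\<Omega> \<in> sets borel" using open_\<Omega> by simp
  have l\<Omega> [measurable]: "\<Omega> \<in> sets lebesgue" using open_\<Omega> by simp
  have "UNIV - \<Omega> \<in> null_sets \<sigma>"
    using out\<sigma> sets.compl_sets[OF b\<Omega>] by (auto simp: null_sets_def s\<sigma>)
  from AE_not_in[OF this] have in\<Omega>: "AE x in \<sigma>. x \<in> \<Omega>" by eventually_elim auto

  \<comment> \<open>For each \<open>t\<close> the exceptional \<sigma>-null set depends on
    \<open>t\<close>. Exchanging the quantifiers gives, for \<sigma>-a.e. \<open>x\<close>, a bound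
    at almost every \<open>t\<close>, which is all that a primitive in \<open>t\<close>
    sees.\<close>
  have f_bound: "AE x in \<sigma>. AE s in lborel. norm (f x s) \<le> 1"
  proof -
    interpret pair_sigma_finite \<sigma> lborel ..
    have f': "(\<lambda>p. f (fst p) (snd p)) \<in> borel_measurable (borel \<Otimes>\<^sub>M borel)"
      using f_meas by (simp add: borel_prod split_beta')
    have "(\<lambda>p. f (fst p) (snd p)) \<in> borel_measurable (\<sigma> \<Otimes>\<^sub>M lborel)"
      using f' by (simp add: measurable_cong_sets[OF sets_pair_measure_cong[OF s\<sigma> sets_lborel] refl])
    then have "{p \<in> space (\<sigma> \<Otimes>\<^sub>M lborel). norm (f (fst p) (snd p)) \<le> 1} \<in> sets (\<sigma> \<Otimes>\<^sub>M lborel)"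
      by measurable
    moreover have "AE s in lborel. AE x in \<sigma>. norm (f x s) \<le> 1"
      using AE_norm_le_1_of_density_le[OF s\<sigma> f_int fin\<sigma> \<sigma>_ub] by simp
    ultimately show ?thesis
      using AE_commute[of "\<lambda>x s. norm (f x s) \<le> 1"] by (simp add: split_beta')
  qed
  have f_x: "f x \<in> borel_measurable borel" for x
    using measurable_compose[of "\<lambda>t. (x, t)" borel "borel \<Otimes>\<^sub>M borel", OF _ f_meas[folded borel_prod]] by simp
  have b_x: "b x \<in> borel_measurable borel" for x
    using measurable_compose[of "\<lambda>t. (x, t)" borel "borel \<Otimes>\<^sub>M borel", OF _ b1_meas[folded borel_prod]] by simp
  have F_bound: "AE x in \<sigma>. \<forall>t. \<bar>Fprim f x t\<bar> \<le> \<bar>t\<bar>"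
    using f_bound
  proof eventually_elim
    case (elim x)
    then show ?case
      using interval_integral_bound(2)[OF f_x elim, of 0] by (simp add: Fprim_def zero_ereal_def)
  qed
  obtain M where M: "M \<ge> 0" "\<And>x t. x \<in> \<Omega> \<Longrightarrow> norm (b x t) \<le> M"
  proof -
    obtain M where "\<forall>x\<in>\<Omega>. \<forall>t. norm (b x t) \<le> M" using b1_bdd by blast
    \<comment> \<open>The absolute value matters for empty \<Omega>, where the bound from (b1) may
      be negative.\<close>
    then show thesis by (intro that[of "\<bar>M\<bar>"]) (auto intro: order_trans[OF _ abs_ge_self])
  qed
  have B_bound: "norm (Bprim b x t) \<le> M * \<bar>t\<bar>" if "x \<in> \<Omega>" for x t
    using interval_integral_bound(2)[OF b_x, of x M 0 t] M(2)[OF that] by (simp add: Bprim_def zero_ereal_def)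
  have F_meas: "(\<lambda>p. Fprim f (fst p) (snd p)) \<in> borel_measurable (borel \<Otimes>\<^sub>M borel)"
    unfolding Fprim_def by (rule interval_primitive_measurable[OF f_meas])
  have B_meas: "(\<lambda>p. Bprim b (fst p) (snd p)) \<in> borel_measurable (borel \<Otimes>\<^sub>M borel)"
    unfolding Bprim_def by (rule interval_primitive_measurable[OF b1_meas])

  obtain C where C: "AE x in lebesgue. x \<in> \<Omega> \<longrightarrow> \<bar>u x\<bar> \<le> C"
    using u_Linf unfolding Linf_def by blast
  have BV_meas: "set_borel_measurable lebesgue \<Omega> v" if "BV \<Omega> v" for v
    using that borel_measurable_integrable unfolding BV_def set_integrable_def set_borel_measurable_def by blast
  interpret u: ess_bounded \<Omega> u C
    using open_\<Omega> BV_meas[OF u_BV] C by unfold_locales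

  have [measurable]: "(\<lambda>x. indicator \<Omega> x * lam x) \<in> borel_measurable borel"
    using lam_meas by (subst (asm) borel_measurable_restrict_space_iff) auto
  have F_lam_meas: "(\<lambda>x. indicator \<Omega> x * Fprim f x (u_lam \<Omega> lam v x)) \<in> borel_measurable borel"
    if "ess_bounded \<Omega> v D" for v D
  proof -
    note [measurable] = ess_bounded.ap_upper_measurable[OF that] ess_bounded.ap_lower_measurable[OF that]
    \<comment> \<open>\<open>lam\<close> and the approximate limits are controlled only on \<Omega>.
      With the indicators, \<open>?w\<close> is Borel on the whole space and equals
      \<open>u_lam\<close> on \<Omega>.\<close>
    let ?w = "\<lambda>x. (1 - indicator \<Omega> x * lam x) * (indicator \<Omega> x * ap_lower \<Omega> v x)
        + (indicator \<Omega> x * lam x) * (indicator \<Omega> x * ap_upper \<Omega> v x)"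
    have "(\<lambda>x. (x, ?w x)) \<in> borel \<rightarrow>\<^sub>M borel \<Otimes>\<^sub>M borel" by measurable
    from measurable_compose[OF this F_meas] have [measurable]: "(\<lambda>x. Fprim f x (?w x)) \<in> borel_measurable borel"
      by simp
    have "(\<lambda>x. indicator \<Omega> x * Fprim f x (?w x)) \<in> borel_measurable borel" by measurable
    moreover have "indicator \<Omega> x * Fprim f x (?w x) = indicator \<Omega> x * Fprim f x (u_lam \<Omega> lam v x)" for x
      by (cases "x \<in> \<Omega>") (auto simp: u_lam_def)
    ultimately show ?thesis by simp
  qed
  have u_lam_between: "ap_lower \<Omega> v x \<le> u_lam \<Omega> lam v x \<and> u_lam \<Omega> lam v x \<le> ap_upper \<Omega> v x"
    if v: "ess_bounded \<Omega> v D" and x: "x \<in> \<Omega>" for v D x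
  proof -
    have le: "ap_lower \<Omega> v x \<le> ap_upper \<Omega> v x" by (rule ess_bounded.ap_lower_le_ap_upper[OF v x])
    have l: "0 \<le> lam x" "lam x \<le> 1" using lam_range[OF x] by auto
    have "u_lam \<Omega> lam v x = ap_lower \<Omega> v x + lam x * (ap_upper \<Omega> v x - ap_lower \<Omega> v x)"
      by (simp add: u_lam_def algebra_simps)
    moreover have "0 \<le> lam x * (ap_upper \<Omega> v x - ap_lower \<Omega> v x)" using le l by simp
    moreover have "lam x * (ap_upper \<Omega> v x - ap_lower \<Omega> v x) \<le> ap_upper \<Omega> v x - ap_lower \<Omega> v x"
      using le l by (intro mult_left_le_one_le) auto
    ultimately show ?thesis by linarith
  qed

  \<comment> \<open>Comparison with a fixed level \<open>q\<close>\<close>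
  have key: "AE x in \<sigma>. ap_lower \<Omega> u x < q \<longrightarrow> q < ap_upper \<Omega> u x \<longrightarrow>
      Fprim f x q \<le> Fprim f x (u_lam \<Omega> lam u x)" for q :: real
  proof -
    define P where "P = {x \<in> \<Omega>. ap_lower \<Omega> u x < q \<and> q < ap_upper \<Omega> u x \<and>
        Fprim f x (u_lam \<Omega> lam u x) < Fprim f x q}"
    have [measurable]: "(\<lambda>x. Fprim f x q) \<in> borel_measurable borel"
      using measurable_compose[of "\<lambda>x. (x, q)" borel "borel \<Otimes>\<^sub>M borel", OF _ F_meas] by simp
    note [measurable] = u.ap_upper_measurable u.ap_lower_measurable F_lam_meas[OF u.ess_bounded_axioms]
    have "{x \<in> space borel. x \<in> \<Omega> \<and> indicator \<Omega> x * ap_lower \<Omega> u x < q \<and> q < indicator \<Omega> x * ap_upper \<Omega> u x \<and>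
        indicator \<Omega> x * Fprim f x (u_lam \<Omega> lam u x) < Fprim f x q} \<in> sets borel"
      by measurable
    also have "{x \<in> space borel. x \<in> \<Omega> \<and> indicator \<Omega> x * ap_lower \<Omega> u x < q \<and> q < indicator \<Omega> x * ap_upper \<Omega> u x \<and>
        indicator \<Omega> x * Fprim f x (u_lam \<Omega> lam u x) < Fprim f x q} = P"
      unfolding P_def by (auto simp: indicator_def)
    finally have P: "P \<in> sets borel" .
    have "emeasure \<sigma> P = 0"
    proof (rule ccontr)
      assume "emeasure \<sigma> P \<noteq> 0"
      moreover have "emeasure \<sigma> P = (SUP K\<in>{K. K \<subseteq> P \<and> compact K}. emeasure \<sigma> K)"
        using P \<sigma>.emeasure_finite by (intro inner_regular s\<sigma>) (auto simp: top_unique)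
      ultimately have "0 < (SUP K\<in>{K. K \<subseteq> P \<and> compact K}. emeasure \<sigma> K)"
        by (simp add: zero_less_iff_neq_zero)
      then obtain K where K: "K \<subseteq> P" "compact K" "0 < emeasure \<sigma> K"
        unfolding less_SUP_iff by blast
      \<comment> \<open>\<open>infdist x {}\<close> is 0 by convention, so \<open>K\<close> must be
        nonempty for the distance to be positive off \<open>K\<close>.\<close>
      have K\<Omega>: "K \<subseteq> \<Omega>" and Kne: "K \<noteq> {}" using K by (auto simp: P_def)
      have bK [measurable]: "K \<in> sets borel" by (rule borel_compact[OF K(2)])
      have Knull: "AE x in lebesgue. x \<notin> K"
        using u.AE_not_between[of q] by eventually_elim (use K(1) in \<open>auto simp: P_def\<close>)
      define U where "U n = \<Omega> \<inter> {x. infdist x K < inverse (real (Suc n))}" for n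
      have openU: "open (U n)" for n
        unfolding U_def using open_\<Omega> by (intro open_Int open_Collect_less continuous_intros)
      have "\<exists>\<eta> V. test_fun (U n) \<eta> \<and> (\<forall>x. 0 \<le> \<eta> x \<and> \<eta> x \<le> 1) \<and> open V \<and> K \<subseteq> V \<and> (\<forall>x\<in>V. \<eta> x = 1)" for n
      proof -
        have "K \<subseteq> U n" using K\<Omega> by (auto simp: U_def)
        from smooth_cutoff[OF K(2) openU this] show ?thesis by metis
      qed
      then obtain \<eta> V where \<eta>: "\<And>n. test_fun (U n) (\<eta> n)" "\<And>n x. 0 \<le> \<eta> n x \<and> \<eta> n x \<le> 1"
        and V: "\<And>n. open (V n)" "\<And>n. K \<subseteq> V n" "\<And>n x. x \<in> V n \<Longrightarrow> \<eta> n x = 1"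
        by metis
      have \<eta>\<Omega>: "test_fun \<Omega> (\<eta> n)" for n
        by (rule test_fun_mono[OF \<eta>(1)]) (auto simp: U_def)
      define us where "us n = (\<lambda>x. (1 - \<eta> n x) * u x + \<eta> n x * q)" for n
      define D where "D = max C \<bar>q\<bar>"
      have us_BV: "BV \<Omega> (us n)" for n
        unfolding us_def by (rule BV_cutoff[OF u_BV open_\<Omega> \<eta>\<Omega> \<eta>(2)])
      have us_bound: "AE x in lebesgue. x \<in> \<Omega> \<longrightarrow> \<bar>us n x\<bar> \<le> D" for n
        using C
      proof (eventually_elim, intro impI)
        fix x assume "x \<in> \<Omega> \<longrightarrow> \<bar>u x\<bar> \<le> C" "x \<in> \<Omega>"
        then have "\<bar>u x\<bar> \<le> D" "\<bar>q\<bar> \<le> D" by (auto simp: D_def)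
        then have "\<bar>(1 - \<eta> n x) * u x\<bar> \<le> (1 - \<eta> n x) * D" "\<bar>\<eta> n x * q\<bar> \<le> \<eta> n x * D"
          using \<eta>(2)[of n x] by (auto simp: abs_mult intro!: mult_mono)
        then show "\<bar>us n x\<bar> \<le> D" unfolding us_def by (simp add: algebra_simps)
      qed
      have us_eb: "ess_bounded \<Omega> (us n) D" for n
        using open_\<Omega> BV_meas[OF us_BV] us_bound by unfold_locales
      \<comment> \<open>Near a point of \<open>K\<close> the function \<open>us n\<close> is
        constant, so \<open>u_lam\<close> takes the value \<open>q\<close> there for every
        \<open>lam\<close>.\<close>
      have on_K: "ap_upper \<Omega> (us n) x = q \<and> ap_lower \<Omega> (us n) x = q" if xK: "x \<in> K" for x n
      proof -
        obtain d where d: "d > 0" "ball x d \<subseteq> V n" using V(1,2)[of n] xK by (meson open_contains_ball subsetD)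
        then have "\<And>y. y \<in> ball x d \<Longrightarrow> us n y = q" using V(3)[of _ n] by (auto simp: us_def)
        moreover have "x \<in> \<Omega>" using xK K\<Omega> by blast
        ultimately show ?thesis
          using ap_upper_cong_local[OF d(1), of x "us n" "\<lambda>_. q" \<Omega>] ap_lower_cong_local[OF d(1), of x "us n" "\<lambda>_. q" \<Omega>]
          by (simp add: ap_upper_const ap_lower_const open_\<Omega>)
      qed
      have off_K: "\<forall>\<^sub>F n in sequentially. us n x = u x \<and>
          ap_upper \<Omega> (us n) x = ap_upper \<Omega> u x \<and> ap_lower \<Omega> (us n) x = ap_lower \<Omega> u x" if "x \<notin> K" for x
      proof -
        \<comment> \<open>With half the distance, the ball of radius \<delta> around
          \<open>x\<close> keeps at least \<delta> away from \<open>K\<close>, so it is disjoint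
          from \<open>U n\<close> once \<open>1/(n+1) < \<delta>\<close>.\<close>
        define \<delta> where "\<delta> = infdist x K / 2"
        have \<delta>: "\<delta> > 0"
          using that K(2) Kne infdist_pos_not_in_closed[of K x] by (simp add: \<delta>_def compact_imp_closed)
        have "\<forall>\<^sub>F n in sequentially. inverse (real (Suc n)) < \<delta>"
          using order_tendstoD(2)[OF LIMSEQ_inverse_real_of_nat \<delta>] .
        then show ?thesis
        proof eventually_elim
          case (elim n)
          have eq: "us n y = u y" if "y \<in> ball x \<delta>" for y
          proof -
            have "infdist x K \<le> infdist y K + dist x y" by (rule infdist_triangle)
            then have "\<not> infdist y K < inverse (real (Suc n))"
              using that elim by (simp add: \<delta>_def)
            then have "\<eta> n y = 0" using test_fun_zero[OF \<eta>(1), of y n] by (simp add: U_def)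
            then show ?thesis by (simp add: us_def)
          qed
          then show ?case
            using ap_upper_cong_local[OF \<delta>, of x "us n" u \<Omega>]
              ap_lower_cong_local[OF \<delta>, of x "us n" u \<Omega>] \<delta> by simp
        qed
      qed
      obtain R where R: "\<And>x. x \<in> K \<Longrightarrow> norm x \<le> R"
        using compact_imp_bounded[OF K(2)] unfolding bounded_iff by blast
      \<comment> \<open>\<Omega> may have infinite Lebesgue measure; a bounded set containing all
        supports yields an integrable majorant.\<close>
      have \<eta>_supp: "\<eta> n x = 0" if "x \<notin> cball 0 (R + 1)" for n x
      proof (rule test_fun_zero[OF \<eta>(1)])
        show "x \<notin> U n"
        proof
          assume "x \<in> U n"
          moreover have "inverse (real (Suc n)) \<le> 1" by (simp add: field_simps)
          ultimately have "infdist x K < 1" by (simp add: U_def)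
          moreover obtain k where "k \<in> K" "infdist x K = dist x k"
            using infdist_attains_inf[of K x] K(2) Kne compact_imp_closed by blast
          ultimately have "norm x \<le> R + 1"
            using R[of k] norm_triangle_ineq2[of x k] by (simp add: dist_norm)
          then show False using that by simp
        qed
      qed

      \<comment> \<open>Admissibility of the modified sequence\<close>
      have adm: "adm_seq \<Omega> \<sigma> u us"
        unfolding adm_seq_def
      proof (intro conjI allI)
        show "BV \<Omega> (us n)" for n by (rule us_BV)
        show "Linf \<Omega> (us n)" for n unfolding Linf_def using us_bound by blast
        show "(\<lambda>n. LINT x:\<Omega>|lebesgue. \<bar>us n x - u x\<bar>) \<longlonglongrightarrow> 0"
        proof -
          have "(\<lambda>n. LINT x:\<Omega>|lebesgue. \<bar>us n x - u x\<bar>) \<longlonglongrightarrow> integral\<^sup>L (lebesgue :: 'a measure) (\<lambda>_. 0)"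
            unfolding set_lebesgue_integral_def
          proof (rule integral_dominated_convergence[where w="\<lambda>x. indicator (cball 0 (R + 1)) x *\<^sub>R (2 * D)"])
            show "(\<lambda>x. indicator \<Omega> x *\<^sub>R \<bar>us n x - u x\<bar>) \<in> borel_measurable lebesgue" for n
            proof -
              have "(\<lambda>x. \<bar>indicator \<Omega> x *\<^sub>R us n x - indicator \<Omega> x *\<^sub>R u x\<bar>) \<in> borel_measurable lebesgue"
                using BV_meas[OF us_BV[of n]] u.meas unfolding set_borel_measurable_def by measurable
              moreover have "\<bar>indicator \<Omega> x *\<^sub>R us n x - indicator \<Omega> x *\<^sub>R u x\<bar> = indicator \<Omega> x *\<^sub>R \<bar>us n x - u x\<bar>" for x
                by (simp add: indicator_def)
              ultimately show ?thesis by simp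
            qed
            show "integrable lebesgue (\<lambda>x::'a. indicator (cball 0 (R + 1)) x *\<^sub>R (2 * D) :: real)"
            proof -
              have "integrable lborel (\<lambda>x::'a. indicator (cball 0 (R + 1)) x *\<^sub>R (2 * D))"
                by (rule borel_integrable_compact) auto
              then show ?thesis
                using integrable_completion borel_measurable_integrable by blast
            qed
            show "AE x in lebesgue. (\<lambda>n. indicator \<Omega> x *\<^sub>R \<bar>us n x - u x\<bar>) \<longlonglongrightarrow> 0"
              using Knull
            proof eventually_elim
              case (elim x)
              show ?case
                by (rule tendsto_eventually, use off_K[OF elim] in eventually_elim) simp
            qed
            show "AE x in lebesgue. norm (indicator \<Omega> x *\<^sub>R \<bar>us n x - u x\<bar>) \<le> indicator (cball 0 (R + 1)) x *\<^sub>R (2 * D)" for n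
              using C us_bound[of n]
            proof eventually_elim
              case (elim x)
              show ?case
              proof (cases "x \<in> cball 0 (R + 1) \<and> x \<in> \<Omega>")
                case True
                then have "\<bar>us n x - u x\<bar> \<le> 2 * D" using elim by (auto simp: D_def)
                then show ?thesis using True by simp
              next
                case False
                have "us n x = u x" if "x \<notin> cball 0 (R + 1)" using \<eta>_supp[OF that] by (simp add: us_def)
                moreover have "D \<ge> 0" by (simp add: D_def max.coboundedI2)
                ultimately show ?thesis using False by (auto simp: indicator_def)
              qed
            qed
          qed simp
          then show ?thesis by simp
        qed
        show "AE x in \<sigma>. ereal (ap_lower \<Omega> u x) \<le> liminf (\<lambda>n. ereal (ap_lower \<Omega> (us n) x)) \<and>
            liminf (\<lambda>n. ereal (ap_lower \<Omega> (us n) x)) \<le> limsup (\<lambda>n. ereal (ap_upper \<Omega> (us n) x)) \<and>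
            limsup (\<lambda>n. ereal (ap_upper \<Omega> (us n) x)) \<le> ereal (ap_upper \<Omega> u x)"
          using in\<Omega>
        proof eventually_elim
          case (elim x)
          show ?case
          proof (cases "x \<in> K")
            case True
            then have "ap_lower \<Omega> u x < q" "q < ap_upper \<Omega> u x" using K(1) by (auto simp: P_def)
            then show ?thesis using on_K[OF True] by (simp add: Liminf_const Limsup_const)
          next
            case False
            have "liminf (\<lambda>n. ereal (ap_lower \<Omega> (us n) x)) = liminf (\<lambda>n. ereal (ap_lower \<Omega> u x))"
              by (rule Liminf_eq, use off_K[OF False] in eventually_elim) simp
            moreover have "limsup (\<lambda>n. ereal (ap_upper \<Omega> (us n) x)) = limsup (\<lambda>n. ereal (ap_upper \<Omega> u x))"
              by (rule Limsup_eq, use off_K[OF False] in eventually_elim) simp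
            ultimately show ?thesis
              using u.ap_lower_le_ap_upper[OF elim] by (simp add: Liminf_const Limsup_const)
          qed
        qed
        \<comment> \<open>The constant \<open>D\<close> serves as \<open>g\<close>, being integrable
          because \<sigma> is finite.\<close>
        have "AE x in \<sigma>. \<bar>ap_upper \<Omega> (us n) x\<bar> \<le> D \<and> \<bar>ap_lower \<Omega> (us n) x\<bar> \<le> D" for n
          using in\<Omega> by eventually_elim
            (use ess_bounded.ap_upper_bounded[OF us_eb] ess_bounded.ap_lower_bounded[OF us_eb] in blast)
        then show "\<exists>g. integrable \<sigma> g \<and> (\<forall>n. AE x in \<sigma>. \<bar>ap_upper \<Omega> (us n) x\<bar> \<le> g x \<and> \<bar>ap_lower \<Omega> (us n) x\<bar> \<le> g x)"
          by (intro exI[of _ "\<lambda>_. D"]) simp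
      qed

      \<comment> \<open>Passage to the limit in the pairing\<close>
      obtain \<phi> W where \<phi>: "test_fun \<Omega> \<phi>" "\<And>x. 0 \<le> \<phi> x \<and> \<phi> x \<le> 1" and W: "K \<subseteq> W" "\<And>x. x \<in> W \<Longrightarrow> \<phi> x = 1"
        by (rule smooth_cutoff[OF K(2) open_\<Omega> K\<Omega>]) metis
      have [measurable]: "\<phi> \<in> borel_measurable borel" using \<phi>(1) by (rule test_fun_measurable)
      have F_int_meas: "(\<lambda>x. \<phi> x * Fprim f x (u_lam \<Omega> lam v x)) \<in> borel_measurable borel"
        if "ess_bounded \<Omega> v D'" for v D'
      proof -
        note [measurable] = F_lam_meas[OF that]
        have "(\<lambda>x. \<phi> x * (indicator \<Omega> x * Fprim f x (u_lam \<Omega> lam v x))) \<in> borel_measurable borel" by measurable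
        moreover have "\<phi> x * (indicator \<Omega> x * Fprim f x (u_lam \<Omega> lam v x)) = \<phi> x * Fprim f x (u_lam \<Omega> lam v x)" for x
          using test_fun_zero[OF \<phi>(1), of x] by (cases "x \<in> \<Omega>") auto
        ultimately show ?thesis by simp
      qed
      have F_int_bound: "AE x in \<sigma>. norm (\<phi> x * Fprim f x (u_lam \<Omega> lam v x)) \<le> D'"
        if v: "ess_bounded \<Omega> v D'" for v D'
        using F_bound in\<Omega>
      proof eventually_elim
        case (elim x)
        have "\<bar>Fprim f x (u_lam \<Omega> lam v x)\<bar> \<le> \<bar>u_lam \<Omega> lam v x\<bar>" using elim by blast
        also have "\<dots> \<le> D'"
          using u_lam_between[OF v elim(2)] ess_bounded.ap_upper_bounded[OF v elim(2)]
            ess_bounded.ap_lower_bounded[OF v elim(2)] by linarith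
        finally show ?case
          using \<phi>(2)[of x] mult_mono[of "\<phi> x" 1 "\<bar>Fprim f x (u_lam \<Omega> lam v x)\<bar>" D'] by (simp add: abs_mult)
      qed
      have F_int: "integrable \<sigma> (\<lambda>x. \<phi> x * Fprim f x (u_lam \<Omega> lam v x))"
        if "ess_bounded \<Omega> v D'" for v D'
        using F_int_bound[OF that] F_int_meas[OF that]
        by (intro \<sigma>.integrable_const_bound[of _ D']) simp_all
      \<comment> \<open>The pointwise limit of the integrands: the level \<open>q\<close> replaces
        \<open>u_lam\<close> on \<open>K\<close>, and nothing changes elsewhere.\<close>
      define H where "H x = (if x \<in> K then \<phi> x * Fprim f x q else \<phi> x * Fprim f x (u_lam \<Omega> lam u x))" for x
      have H_meas [measurable]: "H \<in> borel_measurable borel"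
      proof -
        note [measurable] = F_int_meas[OF u.ess_bounded_axioms]
        show ?thesis unfolding H_def[abs_def] by measurable
      qed
      have lim_F_pt: "(\<lambda>n. \<phi> x * Fprim f x (u_lam \<Omega> lam (us n) x)) \<longlonglongrightarrow> H x" for x
      proof (cases "x \<in> K")
        case True
        then show ?thesis using on_K[OF True] by (simp add: H_def u_lam_def algebra_simps)
      next
        case False
        show ?thesis
          by (rule tendsto_eventually, use off_K[OF False] in eventually_elim) (use False in \<open>simp add: H_def u_lam_def\<close>)
      qed
      have H\<sigma>: "H \<in> borel_measurable \<sigma>" "\<And>n. (\<lambda>x. \<phi> x * Fprim f x (u_lam \<Omega> lam (us n) x)) \<in> borel_measurable \<sigma>"
        using H_meas F_int_meas[OF us_eb] by simp_all
      have lim_F: "integrable \<sigma> H"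
        "(\<lambda>n. \<integral>x. \<phi> x * Fprim f x (u_lam \<Omega> lam (us n) x) \<partial>\<sigma>) \<longlonglongrightarrow> (\<integral>x. H x \<partial>\<sigma>)"
      proof -
        have lim: "AE x in \<sigma>. (\<lambda>n. \<phi> x * Fprim f x (u_lam \<Omega> lam (us n) x)) \<longlonglongrightarrow> H x"
          using lim_F_pt by simp
        have D: "integrable \<sigma> (\<lambda>_. D)" by simp
        show "integrable \<sigma> H"
          by (rule integrable_dominated_convergence[OF H\<sigma> D lim F_int_bound[OF us_eb]])
        show "(\<lambda>n. \<integral>x. \<phi> x * Fprim f x (u_lam \<Omega> lam (us n) x) \<partial>\<sigma>) \<longlonglongrightarrow> (\<integral>x. H x \<partial>\<sigma>)"
          by (rule integral_dominated_convergence[OF H\<sigma> D lim F_int_bound[OF us_eb]])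
      qed
      \<comment> \<open>The limit is the term of \<open>u\<close> itself, since at every point off
        the Lebesgue null set \<open>K\<close> the functions \<open>us n\<close> eventually agree
        with \<open>u\<close>.\<close>
      have lim_B: "(\<lambda>n. LINT x:\<Omega>|lebesgue. Bprim b x (us n x) \<bullet> grad \<phi> x)
          \<longlonglongrightarrow> (LINT x:\<Omega>|lebesgue. Bprim b x (u x) \<bullet> grad \<phi> x)"
      proof -
        have [measurable]: "(\<lambda>x. frechet_derivative \<phi> (at x) i) \<in> borel_measurable borel" if "i \<in> Basis" for i
          by (rule test_fun_measurable[OF test_fun_partial[OF \<phi>(1) that]])
        have "grad \<phi> \<in> borel_measurable borel"
          unfolding grad_def[abs_def] by measurable
        then have [measurable]: "grad \<phi> \<in> borel_measurable lebesgue" by (simp add: measurable_completion)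
        have meas: "(\<lambda>x. indicator \<Omega> x *\<^sub>R (Bprim b x (v x) \<bullet> grad \<phi> x)) \<in> borel_measurable lebesgue"
          if v: "set_borel_measurable lebesgue \<Omega> v" for v
        proof -
          have [measurable]: "(\<lambda>x. indicator \<Omega> x *\<^sub>R v x) \<in> borel_measurable lebesgue"
            using v unfolding set_borel_measurable_def .
          have [measurable]: "(\<lambda>x. x) \<in> lebesgue \<rightarrow>\<^sub>M (borel :: 'a measure)"
            by (simp add: measurable_completion)
          have "(\<lambda>x. (x, indicator \<Omega> x *\<^sub>R v x)) \<in> lebesgue \<rightarrow>\<^sub>M borel \<Otimes>\<^sub>M borel" by measurable
          from measurable_compose[OF this B_meas]
          have [measurable]: "(\<lambda>x. Bprim b x (indicator \<Omega> x *\<^sub>R v x)) \<in> borel_measurable lebesgue" by simp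
          have "(\<lambda>x. indicator \<Omega> x *\<^sub>R (Bprim b x (indicator \<Omega> x *\<^sub>R v x) \<bullet> grad \<phi> x)) \<in> borel_measurable lebesgue"
            by measurable
          moreover have "indicator \<Omega> x *\<^sub>R (Bprim b x (indicator \<Omega> x *\<^sub>R v x) \<bullet> grad \<phi> x)
              = indicator \<Omega> x *\<^sub>R (Bprim b x (v x) \<bullet> grad \<phi> x)" for x
            by (cases "x \<in> \<Omega>") auto
          ultimately show ?thesis by (simp only:)
        qed
        \<comment> \<open>\<open>M * D\<close> bounds \<open>Bprim\<close> along the sequence, and
          the partials of \<phi> have compact support, so this majorant is integrable.\<close>
        define w where "w x = (\<Sum>i\<in>Basis. M * D * \<bar>frechet_derivative \<phi> (at x) i\<bar>)" for x
        have "integrable lborel w"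
          unfolding w_def by (intro Bochner_Integration.integrable_sum integrable_mult_right integrable_abs
              test_fun_integrable[OF test_fun_partial[OF \<phi>(1)]])
        then have wi: "integrable lebesgue w"
          using integrable_completion borel_measurable_integrable by blast
        show ?thesis
          unfolding set_lebesgue_integral_def
        proof (rule integral_dominated_convergence[OF meas[OF u.meas] meas[OF BV_meas[OF us_BV]] wi])
          show "AE x in lebesgue. (\<lambda>n. indicator \<Omega> x *\<^sub>R (Bprim b x (us n x) \<bullet> grad \<phi> x))
              \<longlonglongrightarrow> indicator \<Omega> x *\<^sub>R (Bprim b x (u x) \<bullet> grad \<phi> x)"
            using Knull
          proof eventually_elim
            case (elim x)
            show ?case
              by (rule tendsto_eventually, use off_K[OF elim] in eventually_elim) simp
          qed
          show "AE x in lebesgue. norm (indicator \<Omega> x *\<^sub>R (Bprim b x (us n x) \<bullet> grad \<phi> x)) \<le> w x" for n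
            using us_bound[of n]
          proof eventually_elim
            case (elim x)
            have w0: "0 \<le> w x" unfolding w_def D_def using M(1) by (intro sum_nonneg mult_nonneg_nonneg) auto
            have "\<bar>Bprim b x (us n x) \<bullet> grad \<phi> x\<bar> \<le> w x" if x: "x \<in> \<Omega>"
            proof -
              have nB: "norm (Bprim b x (us n x)) \<le> M * D"
                using B_bound[OF x, of "us n x"] mult_left_mono[of "\<bar>us n x\<bar>" D M] elim x M(1) by auto
              have "\<bar>Bprim b x (us n x) \<bullet> grad \<phi> x\<bar> = \<bar>\<Sum>i\<in>Basis. (Bprim b x (us n x) \<bullet> i) * frechet_derivative \<phi> (at x) i\<bar>"
                by (subst euclidean_inner) (simp add: grad_inner)
              also have "\<dots> \<le> (\<Sum>i\<in>Basis. \<bar>(Bprim b x (us n x) \<bullet> i) * frechet_derivative \<phi> (at x) i\<bar>)"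
                by (rule sum_abs)
              also have "\<dots> \<le> w x"
                unfolding w_def abs_mult
                by (intro sum_mono mult_right_mono order_trans[OF Basis_le_norm nB]) auto
              finally show ?thesis .
            qed
            then show ?case using w0 by (cases "x \<in> \<Omega>") auto
          qed
        qed
      qed
      have "(\<lambda>n. pairing_lam \<Omega> \<sigma> b f lam (us n) \<phi>) \<longlonglongrightarrow>
          - (\<integral>x. H x \<partial>\<sigma>) - (LINT x:\<Omega>|lebesgue. Bprim b x (u x) \<bullet> grad \<phi> x)"
        unfolding pairing_lam_def by (intro tendsto_intros lim_F(2) lim_B)
      then have "liminf (\<lambda>n. ereal (pairing_lam \<Omega> \<sigma> b f lam (us n) \<phi>)) =
          ereal (- (\<integral>x. H x \<partial>\<sigma>) - (LINT x:\<Omega>|lebesgue. Bprim b x (u x) \<bullet> grad \<phi> x))"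
        by (intro lim_imp_Liminf) auto
      \<comment> \<open>The pairing carries \<open>F\<close> with a minus sign, so lower
        semicontinuity becomes an upper bound for the integral of \<open>H\<close>; the divergence
        terms cancel.\<close>
      then have le: "(\<integral>x. H x \<partial>\<sigma>) \<le> (\<integral>x. \<phi> x * Fprim f x (u_lam \<Omega> lam u x) \<partial>\<sigma>)"
        using lsc[OF adm \<phi>(1)] \<phi>(2) by (simp add: pairing_lam_def)
      \<comment> \<open>Off \<open>K\<close> this vanishes whatever \<phi> is; on \<open>K\<close>,
        where \<phi> is 1, it is \<open>F(x,q) - F(x,u^\<lambda>)\<close>, positive by the
        definition of \<open>P\<close>.\<close>
      let ?G = "\<lambda>x. H x - \<phi> x * Fprim f x (u_lam \<Omega> lam u x)"
      have Gi: "integrable \<sigma> ?G"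
        by (intro Bochner_Integration.integrable_diff lim_F(1) F_int[OF u.ess_bounded_axioms])
      have Gpos: "?G x > 0" if "x \<in> K" for x
      proof -
        have "\<phi> x = 1" "x \<in> P" using that W K(1) by auto
        then show ?thesis using that by (simp add: H_def P_def)
      qed
      have Gz: "?G x = 0" if "x \<notin> K" for x
        using that by (simp add: H_def)
      have Gnn: "AE x in \<sigma>. 0 \<le> ?G x"
      proof (rule AE_I2)
        fix x show "0 \<le> ?G x" using Gpos[of x] Gz[of x] by (cases "x \<in> K") auto
      qed
      have "(\<integral>x. ?G x \<partial>\<sigma>) \<le> 0"
        using le lim_F(1) F_int[OF u.ess_bounded_axioms] by simp
      then have "(\<integral>x. ?G x \<partial>\<sigma>) = 0"
        using integral_nonneg_AE[OF Gnn] by linarith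
      then have "AE x in \<sigma>. ?G x = 0"
        using integral_nonneg_eq_0_iff_AE[OF Gi Gnn] by blast
      then have "AE x in \<sigma>. x \<notin> K"
        by eventually_elim (use Gpos in force)
      then have "K \<in> null_sets \<sigma>" using bK by (simp add: AE_iff_null_sets s\<sigma>)
      then show False using K(3) by auto
    qed
    then have "P \<in> null_sets \<sigma>" using P s\<sigma> by auto
    from AE_not_in[OF this] in\<Omega> show ?thesis
      by eventually_elim (auto simp: P_def not_less)
  qed

  \<comment> \<open>From rational levels to the maximum\<close>
  have "AE x in \<sigma>. \<forall>r::rat. ap_lower \<Omega> u x < of_rat r \<longrightarrow> of_rat r < ap_upper \<Omega> u x \<longrightarrow>
      Fprim f x (of_rat r) \<le> Fprim f x (u_lam \<Omega> lam u x)"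
    unfolding AE_all_countable using key by blast
  then show ?thesis
    using f_bound in\<Omega>
  proof eventually_elim
    case (elim x)
    have "continuous_on UNIV (Fprim f x)"
      using interval_primitive_continuous[OF f_x elim(2)] by (simp add: Fprim_def[abs_def])
    then show ?case
      using u_lam_between[OF u.ess_bounded_axioms elim(3)] elim(1)
      by (intro Fhat_eq_if_rational_le) auto
  qed
qed

end
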